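(* Let $d\ge1$, $r_1,\dots,r_d\in\mathbb{Z}$, and let $(U_n)_{n\ge0}$ be a sequence of integers with $U_n=r_1U_{n-1}+\cdots+r_dU_{n-d}$ for all $n\ge d$. Let $C(x)=x^d-r_1x^{d-1}-\cdots-r_d=\prod_{i=0}^{d-1}(x-\alpha_i)$, assume $\Delta=\prod_{0\le i<j<d}(\alpha_i-\alpha_j)^2\neq0$, let $K=\mathbb{Q}(\alpha_0,\dots,\alpha_{d-1})$, and let $C_1,\dots,C_m$ be the monic irreducible factors of $C$ over $\mathbb{Q}$. Then $(U_n)_{n\ge1}$ almost satisfies the Dold condition if and only if there exist $l_1,\dots,l_m\in K$ such that $$U_n=\sum_{j=1}^m l_j\sum_{\beta:\,C_j(\beta)=0}\beta^n\quad\text{for all } n\ge1.$$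
   Context: A sequence of integers $(A_n)_{n\ge1}$ satisfies the Dold condition if $n\mid\sum_{d\mid n}\mu(d)A_{n/d}$ for every $n\in\mathbb{N}_+$ ($\mu$ the Möbius function). It almost satisfies the Dold condition if there is $c\in\mathbb{N}_+$ such that $(cA_n)_{n\ge1}$ satisfies the Dold condition. *)

theory Defs
  imports
    Complex_Main
    "HOL-Computational_Algebra.Computational_Algebra"
    "HOL-Algebra.Generated_Fields"
    "HOL-Algebra.Algebraic_Closure_Type"
begin

definition moebius_mu :: "nat \<Rightarrow> int" where
  "moebius_mu n = (if squarefree n then (- 1) ^ card (prime_factors n) else 0)"

text \<open>Sequences indexed by the positive integers are functions on \<^typ>\<open>nat\<close> whose value at 0
  is never used: for \<open>n \<ge> 1\<close> and \<open>d dvd n\<close> one has \<open>n div d \<ge> 1\<close>.\<close>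

definition dold :: "(nat \<Rightarrow> int) \<Rightarrow> bool" where
  "dold A \<longleftrightarrow> (\<forall>n\<ge>1. int n dvd (\<Sum>d | d dvd n. moebius_mu d * A (n div d)))"

definition almost_dold :: "(nat \<Rightarrow> int) \<Rightarrow> bool" where
  "almost_dold A \<longleftrightarrow> (\<exists>c::nat. c \<ge> 1 \<and> dold (\<lambda>n. int c * A n))"

definition recurrence_poly :: "nat \<Rightarrow> (nat \<Rightarrow> int) \<Rightarrow> int poly" where
  "recurrence_poly d r = monom 1 d - (\<Sum>i=1..d. monom (r i) (d - i))"

definition monic_irreducible_factors :: "rat poly \<Rightarrow> rat poly set" where
  "monic_irreducible_factors p =
     {q. lead_coeff q = 1 \<and> Factorial_Ring.irreducible q \<and> q dvd p}"

definition rat_adjoin :: "complex set \<Rightarrow> complex set" where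
  "rat_adjoin H = generate_field ring_of_type_algebra (\<rat> \<union> H)"

end

theory Submission
  imports
    Defs
    "Jordan_Normal_Form.Char_Poly"
    "HOL-Number_Theory.Residues"
    "HOL-Real_Asymp.Real_Asymp"
begin

text \<open>
  Power sums \<open>T\<close> of a monic integer polynomial satisfy the Dold condition: its reversed polynomial
  factors formally as a product of powers \<open>(1 - x ^ n) ^ b n\<close> with integers \<open>b n\<close>, and comparing
  logarithmic derivatives gives \<open>T n\<close> as the sum of \<open>e * b e\<close> over the divisors \<open>e\<close> of \<open>n\<close>. If \<open>U\<close> is
  a combination of such power sums, a \<open>\<rat>\<close>-linear projection of the complex numbers onto \<open>\<rat>\<close> makes
  the coefficients rational, and clearing denominators yields one direction.

  Conversely, up to a constant factor \<open>U n\<close> is the sum of \<open>u * \<beta> ^ n\<close> over the roots \<open>\<beta>\<close>, where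
  \<open>u = g(\<beta>)\<close> for an integer polynomial \<open>g\<close>. For large primes \<open>p\<close>, the Dold condition at the indices
  \<open>p * k\<close> and a Vandermonde argument give \<open>u ^ p \<equiv> u\<close> modulo \<open>p\<close> in the algebraic integers. Such a \<open>u\<close>
  is rational. Indeed, the \<open>k\<close>-th falling factorial of any \<open>w = a + b * u\<close> with integers \<open>a\<close>, \<open>b\<close> is then
  divisible by \<open>k!\<close> up to a factor exponential in \<open>k\<close>, hence the Vandermonde determinant of the \<open>N = L\<^sup>2\<close>
  numbers \<open>a + b * u\<close>, \<open>0 \<le> a, b < L\<close>, is divisible by a number of size \<open>exp (N\<^sup>2 / 2 * ln N - O(N\<^sup>2))\<close>,
  whereas it and its conjugates are at most \<open>exp (N\<^sup>2 / 4 * ln N + O(N\<^sup>2))\<close>. Thus it vanishes, and two of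
  the numbers coincide. Finally, a rational value of \<open>g\<close> at \<open>\<beta>\<close> is its value at all conjugates of \<open>\<beta>\<close>.
  The argument takes the place of the Chebotarev density theorem.
\<close>

section \<open>Algebraic integers\<close>

unbundle no fps_syntax

text \<open>The determinant trick: \<open>x\<close> is an eigenvalue of the integer matrix
  \<open>M\<close> with nonzero eigenvector \<open>v\<close>, hence a root of its characteristic
  polynomial, which is monic with integer coefficients.\<close>

lemma algebraic_int_if_finite_module:
  fixes x :: complex and v :: "'i \<Rightarrow> complex"
  assumes "finite I" and "k \<in> I" "v k \<noteq> 0"
    and "\<And>i. i \<in> I \<Longrightarrow> x * v i = (\<Sum>j\<in>I. of_int (M i j) * v j)"
  shows "algebraic_int x"
proof -
  define n where "n = card I"
  obtain e where e: "bij_betw e {..<n} I"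
    using assms(1) unfolding n_def by (metis finite_same_card_bij finite_lessThan card_lessThan)
  define A where "A = mat n n (\<lambda>(i, j). M (e i) (e j))"
  define B where "B = map_mat (of_int :: int \<Rightarrow> complex) A"
  have A: "A \<in> carrier_mat n n" and B: "B \<in> carrier_mat n n"
    by (auto simp: A_def B_def)
  obtain k' where k': "k' < n" "e k' = k"
    using e assms(2) by (auto simp: bij_betw_def)
  have "B *\<^sub>v vec n (\<lambda>i. v (e i)) = x \<cdot>\<^sub>v vec n (\<lambda>i. v (e i))"
  proof (rule eq_vecI)
    fix i assume "i < dim_vec (x \<cdot>\<^sub>v vec n (\<lambda>i. v (e i)))"
    then have i: "i < n" by simp
    then have "e i \<in> I" using e by (auto simp: bij_betw_def)
    from assms(4)[OF this] have "x * v (e i) = (\<Sum>j<n. of_int (M (e i) (e j)) * v (e j))"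
      using sum.reindex_bij_betw[OF e, of "\<lambda>j. of_int (M (e i) j) * v j"] by simp
    with i show "(B *\<^sub>v vec n (\<lambda>i. v (e i))) $ i = (x \<cdot>\<^sub>v vec n (\<lambda>i. v (e i))) $ i"
      by (simp add: B_def A_def scalar_prod_def atLeast0LessThan)
  qed (use B in simp)
  moreover have "vec n (\<lambda>i. v (e i)) \<noteq> 0\<^sub>v n"
    using k' assms(3) by (auto simp: vec_eq_iff)
  ultimately have "eigenvalue B x"
    using B unfolding eigenvalue_def eigenvector_def by (intro exI[of _ "vec n (\<lambda>i. v (e i))"]) auto
  then have "poly (char_poly B) x = 0"
    using eigenvalue_root_char_poly[OF B] by blast
  moreover have "char_poly B = map_poly of_int (char_poly A)"
    unfolding B_def by (rule of_int_hom.char_poly_hom[OF A])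
  moreover have "lead_coeff (char_poly A) = 1"
    using degree_monic_char_poly[OF A] by simp
  ultimately show ?thesis
    unfolding algebraic_int_altdef_ipoly by auto
qed

definition int_span :: "'i set \<Rightarrow> ('i \<Rightarrow> complex) \<Rightarrow> complex set" where
  "int_span I v = range (\<lambda>c. \<Sum>j\<in>I. of_int (c j) * v j)"

lemma int_span_add: "a \<in> int_span I v \<Longrightarrow> b \<in> int_span I v \<Longrightarrow> a + b \<in> int_span I v"
proof -
  assume "a \<in> int_span I v" "b \<in> int_span I v"
  then obtain c c' where "a = (\<Sum>j\<in>I. of_int (c j) * v j)" "b = (\<Sum>j\<in>I. of_int (c' j) * v j)"
    by (auto simp: int_span_def)
  then have "a + b = (\<Sum>j\<in>I. of_int (c j + c' j) * v j)"
    by (simp add: sum.distrib algebra_simps)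
  then show ?thesis
    unfolding int_span_def by (intro range_eqI[where x = "\<lambda>j. c j + c' j"])
qed

lemma int_span_scale: "a \<in> int_span I v \<Longrightarrow> of_int k * a \<in> int_span I v"
proof -
  assume "a \<in> int_span I v"
  then obtain c where "a = (\<Sum>j\<in>I. of_int (c j) * v j)"
    by (auto simp: int_span_def)
  then have "of_int k * a = (\<Sum>j\<in>I. of_int (k * c j) * v j)"
    by (simp add: sum_distrib_left algebra_simps)
  then show ?thesis
    unfolding int_span_def by (intro range_eqI[where x = "\<lambda>j. k * c j"])
qed

lemma int_span_0: "0 \<in> int_span I v"
  unfolding int_span_def by (rule image_eqI[of _ _ "\<lambda>_. 0"]) auto

lemma int_span_sum: "(\<And>x. x \<in> Y \<Longrightarrow> f x \<in> int_span I v) \<Longrightarrow> sum f Y \<in> int_span I v"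
  by (induction Y rule: infinite_finite_induct) (auto intro: int_span_add int_span_0)

lemma int_span_base: "finite I \<Longrightarrow> i \<in> I \<Longrightarrow> v i \<in> int_span I v"
  unfolding int_span_def
  by (rule image_eqI[of _ _ "\<lambda>j. if j = i then 1 else 0"]) (auto simp: if_distrib[of of_int] if_distrib[of "\<lambda>a. a * _"] cong: if_cong)

lemma int_span_stable:
  assumes "\<And>i. i \<in> I \<Longrightarrow> x * v i \<in> int_span I v" and "a \<in> int_span I v"
  shows "x * a \<in> int_span I v"
proof -
  obtain c where "a = (\<Sum>j\<in>I. of_int (c j) * v j)"
    using assms(2) by (auto simp: int_span_def)
  then have "x * a = (\<Sum>j\<in>I. of_int (c j) * (x * v j))"
    by (simp add: sum_distrib_left algebra_simps)
  also have "\<dots> \<in> int_span I v"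
    by (intro int_span_sum int_span_scale assms(1))
  finally show ?thesis .
qed

lemma algebraic_int_if_int_span_stable:
  assumes "finite I" "k \<in> I" "v k \<noteq> 0" "\<And>i. i \<in> I \<Longrightarrow> x * v i \<in> int_span I v"
  shows "algebraic_int x"
proof -
  have "\<forall>i\<in>I. \<exists>c. x * v i = (\<Sum>j\<in>I. of_int (c j) * v j)"
    using assms(4) unfolding int_span_def by blast
  then obtain M where "\<And>i. i \<in> I \<Longrightarrow> x * v i = (\<Sum>j\<in>I. of_int (M i j) * v j)"
    by metis
  then show ?thesis
    by (rule algebraic_int_if_finite_module[of I k v x M, OF assms(1-3)])
qed

lemma algebraic_int_power_reduce:
  fixes x :: complex
  assumes "algebraic_int x"
  obtains m c where "m > 0" "x ^ m = (\<Sum>k<m. of_int (c k) * x ^ k)"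
proof -
  obtain p :: "int poly" where p: "poly (map_poly of_int p) x = 0" "lead_coeff p = 1"
    using assms unfolding algebraic_int_altdef_ipoly by blast
  define m where "m = degree p"
  have "poly (map_poly of_int p) x = (\<Sum>k\<le>m. of_int (coeff p k) * x ^ k)"
    by (simp add: poly_altdef m_def coeff_map_poly)
  also have "\<dots> = x ^ m + (\<Sum>k<m. of_int (coeff p k) * x ^ k)"
    using p(2) by (simp flip: lessThan_Suc_atMost add: m_def)
  finally have *: "x ^ m = (\<Sum>k<m. of_int (- coeff p k) * x ^ k)"
    using p(1) by (simp add: sum_negf add_eq_0_iff2)
  \<comment> \<open>For \<open>m = 0\<close> the relation would read \<open>1 = 0\<close>.\<close>
  moreover have "m > 0"
    using * by (cases m) auto
  ultimately show ?thesis by (intro that)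
qed

text \<open>The monomials \<open>x ^ a * y ^ b\<close> with \<open>a < m\<close>,
  \<open>b < n\<close> span a group that multiplication by \<open>x\<close> and by \<open>y\<close>
  maps into itself, since the monic relations reduce \<open>x ^ m\<close> and \<open>y ^ n\<close>.
  The group is then stable under \<open>x + y\<close> and \<open>x * y\<close> too, and the
  determinant trick applies because \<open>1\<close> is among the generators.\<close>

lemma algebraic_int_add_mult:
  fixes x y :: complex
  assumes "algebraic_int x" "algebraic_int y"
  shows "algebraic_int (x + y)" "algebraic_int (x * y)"
proof -
  obtain m c where m: "m > 0" "x ^ m = (\<Sum>k<m. of_int (c k) * x ^ k)"
    using algebraic_int_power_reduce[OF assms(1)] .
  obtain n c' where n: "n > 0" "y ^ n = (\<Sum>k<n. of_int (c' k) * y ^ k)"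
    using algebraic_int_power_reduce[OF assms(2)] .
  define I where "I = {..<m} \<times> {..<n}"
  define v where "v = (\<lambda>(a, b). x ^ a * y ^ b)"
  have fin: "finite I" and k: "(0, 0) \<in> I" "v (0, 0) \<noteq> 0"
    using m n by (auto simp: I_def v_def)
  have base: "x ^ a * y ^ b \<in> int_span I v" if "a < m" "b < n" for a b
    using int_span_base[OF fin, of "(a, b)" v] that by (simp add: I_def v_def)
  have x: "x * v i \<in> int_span I v" if iI: "i \<in> I" for i
  proof -
    obtain a b where i: "i = (a, b)" "a < m" "b < n" using iI by (auto simp: I_def)
    have xv: "x * v i = x ^ Suc a * y ^ b" by (simp add: i v_def)
    show ?thesis
    proof (cases "Suc a < m")
      case True
      then show ?thesis unfolding xv using base i by blast
    next
      case False
      then have "Suc a = m" using i by simp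
      then have "x * v i = (\<Sum>k<m. of_int (c k) * x ^ k) * y ^ b"
        using m(2) xv by simp
      also have "\<dots> = (\<Sum>k<m. of_int (c k) * (x ^ k * y ^ b))"
        by (simp add: sum_distrib_right mult.assoc)
      finally have "x * v i = (\<Sum>k<m. of_int (c k) * (x ^ k * y ^ b))" .
      then show ?thesis using i by (auto intro!: int_span_sum int_span_scale base)
    qed
  qed
  have y: "y * v i \<in> int_span I v" if iI: "i \<in> I" for i
  proof -
    obtain a b where i: "i = (a, b)" "a < m" "b < n" using iI by (auto simp: I_def)
    have yv: "y * v i = x ^ a * y ^ Suc b" by (simp add: i v_def)
    show ?thesis
    proof (cases "Suc b < n")
      case True
      then show ?thesis unfolding yv using base i by blast
    next
      case False
      then have "Suc b = n" using i by simp
      then have "y * v i = x ^ a * (\<Sum>k<n. of_int (c' k) * y ^ k)"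
        using n(2) yv by simp
      also have "\<dots> = (\<Sum>k<n. of_int (c' k) * (x ^ a * y ^ k))"
        by (simp add: sum_distrib_left mult.left_commute)
      finally have "y * v i = (\<Sum>k<n. of_int (c' k) * (x ^ a * y ^ k))" .
      then show ?thesis using i by (auto intro!: int_span_sum int_span_scale base)
    qed
  qed
  show "algebraic_int (x + y)"
    by (rule algebraic_int_if_int_span_stable[where v = v, OF fin k])
      (auto simp: ring_distribs intro: int_span_add x y)
  show "algebraic_int (x * y)"
    by (rule algebraic_int_if_int_span_stable[where v = v, OF fin k])
      (auto simp: mult.assoc intro: int_span_stable[OF x y])
qed

lemma algebraic_int_of_int [simp, intro]: "algebraic_int (of_int k :: complex)"
  by (rule int_imp_algebraic_int) simp

lemma algebraic_int_diff:
  fixes x y :: complex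
  assumes "algebraic_int x" "algebraic_int y"
  shows "algebraic_int (x - y)"
  using algebraic_int_add_mult(1)[of x "- y"] assms by simp

lemma algebraic_int_sum:
  fixes f :: "'i \<Rightarrow> complex"
  shows "(\<And>i. i \<in> I \<Longrightarrow> algebraic_int (f i)) \<Longrightarrow> algebraic_int (sum f I)"
  by (induction I rule: infinite_finite_induct) (auto intro: algebraic_int_add_mult)

lemma algebraic_int_prod:
  fixes f :: "'i \<Rightarrow> complex"
  shows "(\<And>i. i \<in> I \<Longrightarrow> algebraic_int (f i)) \<Longrightarrow> algebraic_int (prod f I)"
  by (induction I rule: infinite_finite_induct) (auto intro: algebraic_int_add_mult)

lemma algebraic_int_power:
  "algebraic_int (x :: complex) \<Longrightarrow> algebraic_int (x ^ n)"
  by (induction n) (auto intro: algebraic_int_add_mult)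

lemma algebraic_int_poly:
  fixes p :: "complex poly"
  assumes "\<And>k. algebraic_int (coeff p k)" "algebraic_int x"
  shows "algebraic_int (poly p x)"
  unfolding poly_altdef by (intro algebraic_int_sum algebraic_int_add_mult algebraic_int_power assms)

lemma algebraic_int_of_nat [simp, intro]: "algebraic_int (of_nat k :: complex)"
  by (rule int_imp_algebraic_int) simp

lemma algebraic_int_coeff_mult:
  fixes p q :: "complex poly"
  assumes "\<And>k. algebraic_int (coeff p k)" "\<And>k. algebraic_int (coeff q k)"
  shows "algebraic_int (coeff (p * q) k)"
  unfolding coeff_mult by (intro algebraic_int_sum algebraic_int_add_mult assms)

lemma algebraic_int_coeff_prod:
  fixes f :: "'i \<Rightarrow> complex poly"
  assumes "\<And>i k. i \<in> I \<Longrightarrow> algebraic_int (coeff (f i) k)"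
  shows "algebraic_int (coeff (\<Prod>i\<in>I. f i) k)"
  using assms
proof (induction I arbitrary: k rule: infinite_finite_induct)
  case (insert i I)
  then show ?case by (auto intro!: algebraic_int_coeff_mult)
qed (auto simp: coeff_1)

lemma algebraic_int_coeff_linear:
  "algebraic_int (c :: complex) \<Longrightarrow> algebraic_int (coeff [:- c, 1:] k)"
  by (auto simp: coeff_pCons split: nat.splits)

text \<open>A polynomial relation with nonzero constant term \<open>a\<close> has the form
  \<open>x * p(x) = - a\<close>, so the cofactor is \<open>p(x)\<close>. Vanishing constant terms
  are removed by cancelling \<open>x\<close>, which is the induction over the polynomial.\<close>

lemma algebraic_int_dvd_int:
  fixes x :: complex
  assumes "algebraic_int x" "x \<noteq> 0"
  obtains y m where "algebraic_int y" "m \<noteq> 0" "y * x = of_int m"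
proof -
  have "\<exists>y m. algebraic_int y \<and> m \<noteq> 0 \<and> y * x = of_int m"
    if "p \<noteq> 0" "poly (map_poly of_int p) x = 0" for p :: "int poly"
    using that
  proof (induction p)
    case (pCons a p)
    let ?y = "poly (map_poly of_int p) x"
    have eq: "of_int a + x * ?y = 0" using pCons.prems by (simp add: map_poly_pCons)
    show ?case
    proof (cases "a = 0")
      case True
      then show ?thesis using eq assms(2) pCons by auto
    next
      case False
      have "algebraic_int ?y"
        by (rule algebraic_int_poly[OF _ assms(1)]) (simp add: coeff_map_poly)
      moreover have "?y * x = of_int (- a)" using eq by (simp add: add_eq_0_iff2 mult.commute)
      ultimately show ?thesis using False by (metis neg_equal_0_iff_equal)
    qed
  qed simp
  moreover obtain p :: "int poly" where "poly (map_poly of_int p) x = 0" "lead_coeff p = 1"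
    using assms(1) unfolding algebraic_int_altdef_ipoly by blast
  ultimately show ?thesis using that by (metis leading_coeff_0_iff zero_neq_one)
qed

section \<open>Divisibility by natural numbers in the ring of algebraic integers\<close>

definition alg_dvd :: "nat \<Rightarrow> complex \<Rightarrow> bool" where
  "alg_dvd n x \<longleftrightarrow> algebraic_int (x / of_nat n)"

lemma alg_dvd_0 [simp]: "alg_dvd n 0"
  by (simp add: alg_dvd_def)

lemma alg_dvd_1: "alg_dvd 1 x \<longleftrightarrow> algebraic_int x"
  by (simp add: alg_dvd_def)

lemma alg_dvd_add: "alg_dvd n x \<Longrightarrow> alg_dvd n y \<Longrightarrow> alg_dvd n (x + y)"
  by (simp add: alg_dvd_def add_divide_distrib algebraic_int_add_mult)

lemma alg_dvd_diff: "alg_dvd n x \<Longrightarrow> alg_dvd n y \<Longrightarrow> alg_dvd n (x - y)"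
  by (simp add: alg_dvd_def diff_divide_distrib algebraic_int_diff)

lemma alg_dvd_mult_left: "algebraic_int y \<Longrightarrow> alg_dvd n x \<Longrightarrow> alg_dvd n (y * x)"
  unfolding alg_dvd_def times_divide_eq_right[symmetric] by (rule algebraic_int_add_mult)

lemma alg_dvd_sum: "(\<And>i. i \<in> I \<Longrightarrow> alg_dvd n (f i)) \<Longrightarrow> alg_dvd n (sum f I)"
  by (induction I rule: infinite_finite_induct) (auto intro: alg_dvd_add)

lemma alg_dvd_of_int: "int n dvd k \<Longrightarrow> n > 0 \<Longrightarrow> alg_dvd n (of_int k)"
  by (auto simp: alg_dvd_def elim!: dvdE)

lemma alg_dvd_mult: "alg_dvd a x \<Longrightarrow> alg_dvd b y \<Longrightarrow> alg_dvd (a * b) (x * y)"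
  unfolding alg_dvd_def of_nat_mult times_divide_times_eq[symmetric] by (rule algebraic_int_add_mult)

text \<open>Bezout: for \<open>u * a + v * b = 1\<close> the quotient \<open>x / (a * b)\<close>
  equals \<open>u * (x / b) + v * (x / a)\<close>.\<close>

lemma alg_dvd_mult_coprime:
  assumes "Rings.coprime a b" "a > 0" "b > 0" "alg_dvd a x" "alg_dvd b x"
  shows "alg_dvd (a * b) x"
proof -
  obtain u v where uv: "u * int a + v * int b = 1"
    using bezout_int[of "int a" "int b"] coprime_imp_gcd_eq_1[of "int a" "int b"] assms(1)
    unfolding coprime_int_iff by metis
  have one: "of_int u * of_nat a + of_int v * of_nat b = (1 :: complex)"
    using arg_cong[OF uv, of "of_int :: int \<Rightarrow> complex"] by simp
  have "x / of_nat (a * b) = (of_int u * of_nat a + of_int v * of_nat b) * x / of_nat (a * b)"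
    unfolding one by simp
  also have "\<dots> = of_int u * (x / of_nat b) + of_int v * (x / of_nat a)"
    using assms(2,3) by (simp add: field_simps)
  finally have eq: "x / of_nat (a * b) = of_int u * (x / of_nat b) + of_int v * (x / of_nat a)" .
  show ?thesis
    using assms(4,5) unfolding alg_dvd_def by (subst eq) (intro algebraic_int_add_mult algebraic_int_of_int)
qed

lemma alg_dvd_prod_coprime:
  assumes "finite P" "alg_dvd 1 x" "\<And>p. p \<in> P \<Longrightarrow> alg_dvd (f p) x \<and> f p > 0"
    and "\<And>p q. p \<in> P \<Longrightarrow> q \<in> P \<Longrightarrow> p \<noteq> q \<Longrightarrow> Rings.coprime (f p) (f q)"
  shows "alg_dvd (\<Prod>p\<in>P. f p) x"
  using assms
proof (induction P rule: finite_induct)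
  case (insert p P)
  have "Rings.coprime (f p) (\<Prod>p\<in>P. f p)"
    using insert by (intro prod_coprime_right) auto
  then have "alg_dvd (f p * (\<Prod>p\<in>P. f p)) x"
    using insert by (intro alg_dvd_mult_coprime) (auto intro!: prod_pos)
  then show ?case using insert by simp
qed auto

text \<open>Bezout: for \<open>u * m + v * n = 1\<close> the quotient \<open>x / n\<close> equals
  \<open>u * (m * x / n) + v * x\<close>.\<close>

lemma alg_dvd_cancel_coprime:
  assumes "Rings.coprime m (int n)" "n > 0" "algebraic_int x" "alg_dvd n (of_int m * x)"
  shows "alg_dvd n x"
proof -
  obtain u v where uv: "u * m + v * int n = 1"
    using assms(1) bezout_int[of m "int n"] by (auto simp: coprime_iff_gcd_eq_1)
  have one: "of_int u * of_int m + of_int v * of_nat n = (1 :: complex)"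
    using arg_cong[OF uv, of "of_int :: int \<Rightarrow> complex"] by simp
  have "x / of_nat n = (of_int u * of_int m + of_int v * of_nat n) * x / of_nat n"
    unfolding one by simp
  also have "\<dots> = of_int u * (of_int m * x / of_nat n) + of_int v * x"
    using assms(2) by (simp add: field_simps)
  finally have eq: "x / of_nat n = of_int u * (of_int m * x / of_nat n) + of_int v * x" .
  show ?thesis
    using assms(3,4) unfolding alg_dvd_def by (subst eq) (intro algebraic_int_add_mult algebraic_int_of_int)
qed

text \<open>The factors are exchanged one at a time.\<close>

lemma alg_dvd_prod_diff:
  assumes "\<And>i. i \<in> I \<Longrightarrow> algebraic_int (f i) \<and> algebraic_int (g i) \<and> alg_dvd n (f i - g i)"
  shows "alg_dvd n (prod f I - prod g I)"
  using assms
proof (induction I rule: infinite_finite_induct)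
  case (insert i I)
  have "prod f (insert i I) - prod g (insert i I) =
      prod f I * (f i - g i) + g i * (prod f I - prod g I)"
    using insert.hyps by (simp add: algebra_simps)
  then show ?case
    using insert by (auto intro!: alg_dvd_add alg_dvd_mult_left algebraic_int_prod)
qed auto

section \<open>The Dold condition for power sums\<close>

lemma moebius_mu_prime_mult:
  assumes "prime p" "\<not> p dvd k"
  shows "moebius_mu (p * k) = - moebius_mu k"
proof -
  have k: "k > 0" using assms(2) by (intro Nat.gr0I) auto
  have cop: "Rings.coprime p k" using assms by (simp add: prime_imp_coprime)
  have "squarefree (p * k) \<longleftrightarrow> squarefree k"
    using squarefree_mult_coprime[OF cop] squarefree_prime[of p] assms(1) squarefree_multD(2)[of p k]
    by auto
  moreover have "prime_factors (p * k) = insert p (prime_factors k)"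
    using assms k by (subst prime_factors_product) (auto simp: prime_prime_factors)
  moreover have "p \<notin> prime_factors k" using assms by auto
  ultimately show ?thesis by (simp add: moebius_mu_def)
qed

lemma sum_divisors_prime_mult:
  fixes p k :: nat
  assumes "prime p" "\<not> p dvd k"
  shows "(\<Sum>e | e dvd p * k. f e) = (\<Sum>e | e dvd k. f e) + (\<Sum>e | e dvd k. f (p * e))"
proof -
  have k: "k > 0" using assms(2) by (intro Nat.gr0I) auto
  have p: "p > 0" using assms(1) prime_gt_0_nat by blast
  have "{e. e dvd p * k} = {e. e dvd k} \<union> (*) p ` {e. e dvd k}"
  proof (intro equalityI subsetI)
    fix e assume "e \<in> {e. e dvd p * k}"
    then have e: "e dvd p * k" by simp
    show "e \<in> {e. e dvd k} \<union> (*) p ` {e. e dvd k}"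
    proof (cases "p dvd e")
      case True
      then obtain e' where "e = p * e'" by auto
      then show ?thesis using e p by auto
    next
      case False
      then have "Rings.coprime e p" using prime_imp_coprime[OF assms(1)] by (simp add: coprime_commute)
      then show ?thesis using e by (auto simp: coprime_dvd_mult_right_iff)
    qed
  qed (auto intro: dvd_mult)
  moreover have "{e. e dvd k} \<inter> (*) p ` {e. e dvd k} = {}"
    using assms(2) by (auto dest: dvd_mult_left)
  moreover have "inj_on ((*) p) {e. e dvd k}" using p by (auto simp: inj_on_def)
  ultimately show ?thesis using k
    by (simp add: sum.union_disjoint sum.reindex)
qed

text \<open>For a prime \<open>p\<close> dividing \<open>n\<close> and the \<open>p\<close>-free
  part \<open>k\<close> of \<open>n\<close>, only divisors of \<open>p * k\<close> contribute, and
  among these the terms of \<open>e\<close> and \<open>p * e\<close> cancel.\<close>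

lemma sum_moebius_mu:
  assumes "n > (0::nat)"
  shows "(\<Sum>e | e dvd n. moebius_mu e) = (if n = 1 then 1 else 0)"
proof (cases "n = 1")
  case False
  then obtain p where p: "prime p" "p dvd n" using prime_factor_nat by blast
  obtain a k where n: "n = p ^ a * k" "\<not> p dvd k"
    using multiplicity_decompose'[of n p] assms p(1) by (metis gr_implies_not0 not_prime_unit mult.commute)
  have a: "a > 0" using p n by (intro Nat.gr0I) auto
  have k: "k > 0" using n(2) by (intro Nat.gr0I) auto
  \<comment> \<open>A squarefree divisor of \<open>n\<close> contains \<open>p\<close> at most once,
    hence divides \<open>p * k\<close>.\<close>
  have "moebius_mu e = 0" if e: "e dvd n" "\<not> e dvd p * k" for e
  proof (rule ccontr)
    assume "moebius_mu e \<noteq> 0"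
    then have sq: "squarefree e" by (auto simp: moebius_mu_def split: if_splits)
    show False
    proof (cases "p dvd e")
      case False
      then have "Rings.coprime e (p ^ a)"
        using prime_imp_coprime[OF p(1) False] by (simp add: coprime_commute)
      then show False using e n(1) by (auto simp: coprime_dvd_mult_right_iff)
    next
      case True
      then obtain e' where e': "e = p * e'" by auto
      have "\<not> p dvd e'"
      proof
        assume "p dvd e'"
        then have "p\<^sup>2 dvd e" by (auto simp: e' power2_eq_square)
        then show False using sq p(1) not_prime_unit[of p] by (auto simp: squarefree_def)
      qed
      then have "Rings.coprime e' (p ^ a)"
        using prime_imp_coprime[OF p(1)] by (simp add: coprime_commute)
      moreover have "e' dvd p ^ a * k" using e(1) e' n(1) by (metis dvd_mult_right)
      ultimately have "e' dvd k" by (simp add: coprime_dvd_mult_right_iff)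
      then show False using e(2) e' by simp
    qed
  qed
  moreover have "p * k dvd n"
    unfolding n(1) using a by (intro mult_dvd_mono dvd_power) auto
  ultimately have "(\<Sum>e | e dvd n. moebius_mu e) = (\<Sum>e | e dvd p * k. moebius_mu e)"
    using assms by (intro sum.mono_neutral_right) (auto dest: dvd_trans)
  also have "\<dots> = 0"
    unfolding sum_divisors_prime_mult[OF p(1) n(2)] sum.distrib[symmetric]
  proof (intro sum.neutral ballI)
    fix e assume "e \<in> {e. e dvd k}"
    then have "\<not> p dvd e" using n(2) dvd_trans[of p e k] by auto
    then show "moebius_mu e + moebius_mu (p * e) = 0"
      using moebius_mu_prime_mult[OF p(1)] by simp
  qed
  finally show ?thesis using False by simp
qed (auto simp: moebius_mu_def)

text \<open>Moebius inversion: after interchanging the sums only \<open>n * b n\<close> remains. The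
  representation is asked for only up to \<open>n\<close>, so that \<open>b\<close> may come from a
  finite stage of an infinite product.\<close>

lemma dvd_moebius_sum_if_divisor_sum:
  fixes A b :: "nat \<Rightarrow> int"
  assumes "n > 0" and A: "\<And>m. m > 0 \<Longrightarrow> m \<le> n \<Longrightarrow> A m = (\<Sum>e | e dvd m. int e * b e)"
  shows "int n dvd (\<Sum>d | d dvd n. moebius_mu d * A (n div d))"
proof -
  have "(\<Sum>d | d dvd n. moebius_mu d * A (n div d)) =
      (\<Sum>d | d dvd n. \<Sum>e | e \<in> {e. e dvd n} \<and> d * e dvd n. moebius_mu d * (int e * b e))"
  proof (intro sum.cong refl)
    fix d assume "d \<in> {d. d dvd n}"
    then obtain m where m: "n = d * m" by auto
    then have "d > 0" "m > 0" using assms(1) by auto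
    moreover have "{e. e \<in> {e. e dvd n} \<and> d * e dvd n} = {e. e dvd m}"
      using m \<open>d > 0\<close> by (auto intro: dvd_mult dest: dvd_mult_right)
    ultimately show "moebius_mu d * A (n div d) =
        (\<Sum>e | e \<in> {e. e dvd n} \<and> d * e dvd n. moebius_mu d * (int e * b e))"
      using A[of m] m by (simp add: sum_distrib_left)
  qed
  also have "\<dots> = (\<Sum>e | e dvd n. \<Sum>d | d \<in> {d. d dvd n} \<and> d * e dvd n. moebius_mu d * (int e * b e))"
    using assms(1) by (intro sum.swap_restrict) auto
  also have "\<dots> = (\<Sum>e | e dvd n. if e = n then int n * b n else 0)"
  proof (intro sum.cong refl)
    fix e assume "e \<in> {e. e dvd n}"
    then obtain m where m: "n = m * e" by (metis dvdE mem_Collect_eq mult.commute)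
    then have pos: "e > 0" "m > 0" using assms(1) by auto
    have "{d. d \<in> {d. d dvd n} \<and> d * e dvd n} = {d. d dvd m}"
      using m \<open>e > 0\<close> by (auto intro: dvd_mult2)
    then have "(\<Sum>d | d \<in> {d. d dvd n} \<and> d * e dvd n. moebius_mu d * (int e * b e))
        = (\<Sum>d | d dvd m. moebius_mu d) * (int e * b e)"
      by (simp add: sum_distrib_right)
    then show "(\<Sum>d | d \<in> {d. d dvd n} \<and> d * e dvd n. moebius_mu d * (int e * b e)) =
        (if e = n then int n * b n else 0)"
      using sum_moebius_mu[OF \<open>m > 0\<close>] m pos by auto
  qed
  also have "\<dots> = int n * b n" using assms(1) by (simp add: sum.delta)
  finally show ?thesis by simp
qed

section \<open>Formal logarithmic derivatives and products of powers of
  \<open>1 - x ^ n\<close>\<close>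

text \<open>In other words \<open>A = - x * f' / f\<close>, cleared of the denominator so that it
  makes sense over the integers. Products of \<open>f\<close> turn into sums of \<open>A\<close>,
  and \<open>1 - \<beta> * x\<close> yields the powers \<open>\<beta> ^ n\<close> with
  \<open>n \<ge> 1\<close>.\<close>

definition neg_log_deriv :: "'a::comm_ring_1 fps \<Rightarrow> 'a fps \<Rightarrow> bool" where
  "neg_log_deriv f A \<longleftrightarrow> f * A = - (fps_X * fps_deriv f)"

lemma neg_log_deriv_mult:
  "neg_log_deriv f A \<Longrightarrow> neg_log_deriv g B \<Longrightarrow> neg_log_deriv (f * g) (A + B)"
proof -
  assume "neg_log_deriv f A" "neg_log_deriv g B"
  then have *: "f * A = - (fps_X * fps_deriv f)" "g * B = - (fps_X * fps_deriv g)"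
    by (auto simp: neg_log_deriv_def)
  have "f * g * (A + B) = g * (f * A) + f * (g * B)" by (simp add: algebra_simps)
  also have "\<dots> = - (fps_X * fps_deriv (f * g))" unfolding * by (simp add: algebra_simps)
  finally show ?thesis by (simp add: neg_log_deriv_def)
qed

lemma neg_log_deriv_prod:
  "finite S \<Longrightarrow> (\<And>x. x \<in> S \<Longrightarrow> neg_log_deriv (f x) (A x)) \<Longrightarrow>
    neg_log_deriv (\<Prod>x\<in>S. f x) (\<Sum>x\<in>S. A x)"
  by (induction S rule: finite_induct) (auto intro: neg_log_deriv_mult simp: neg_log_deriv_def[of 1])

lemma neg_log_deriv_inverse:
  assumes "f * g = 1" "neg_log_deriv f A"
  shows "neg_log_deriv g (- A)"
proof -
  have "fps_deriv (f * g) = 0" by (simp add: assms(1))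
  then have d: "f * fps_deriv g = - (fps_deriv f * g)" by (simp add: add_eq_0_iff2)
  have "f * (fps_X * fps_deriv g) = fps_X * (f * fps_deriv g)" by (simp add: algebra_simps)
  also have "\<dots> = g * - (fps_X * fps_deriv f)" unfolding d by (simp add: algebra_simps)
  also have "\<dots> = g * (f * A)" using assms(2) by (simp add: neg_log_deriv_def)
  also have "\<dots> = (f * g) * A" by (simp add: algebra_simps)
  finally have "f * (fps_X * fps_deriv g) = A" by (simp add: assms(1))
  then have "g * A = (f * g) * (fps_X * fps_deriv g)" by (metis mult.assoc mult.commute)
  then show ?thesis by (simp add: assms(1) neg_log_deriv_def)
qed

text \<open>For \<open>n > 0\<close> this is the expansion of
  \<open>n * x ^ n / (1 - x ^ n)\<close>.\<close>

definition multiples_fps :: "nat \<Rightarrow> int fps" where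
  "multiples_fps n = Abs_fps (\<lambda>k. if k > 0 \<and> n dvd k then int n else 0)"

lemma neg_log_deriv_one_minus_X_power:
  assumes "n > 0"
  shows "neg_log_deriv (1 - fps_X ^ n) (multiples_fps n)"
  unfolding neg_log_deriv_def
proof (rule fps_ext)
  fix k
  have "n dvd k - n \<longleftrightarrow> n dvd k" if "k \<ge> n"
    using that by (simp add: dvd_diff_nat dvd_minus_self)
  then show "fps_nth ((1 - fps_X ^ n) * multiples_fps n) k = fps_nth (- (fps_X * fps_deriv (1 - fps_X ^ n))) k"
    using assms
    by (cases k) (auto simp: left_diff_distrib fps_X_power_mult_nth multiples_fps_def
        fps_X_power_nth dest: nat_dvd_not_less)
qed

text \<open>For \<open>n > 0\<close> this is congruence to 1 modulo \<open>x ^ n\<close>.\<close>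

definition flat_below :: "nat \<Rightarrow> int fps \<Rightarrow> bool" where
  "flat_below n f \<longleftrightarrow> fps_nth f 0 = 1 \<and> (\<forall>j. 0 < j \<and> j < n \<longrightarrow> fps_nth f j = 0)"

lemma flat_below_mult_nth:
  assumes "flat_below n f" "0 < j" "j \<le> n"
  shows "fps_nth (f * g) j = fps_nth g j + fps_nth f j * fps_nth g 0"
proof -
  have "fps_nth (f * g) j = (\<Sum>i=0..j. fps_nth f i * fps_nth g (j - i))" by (simp add: fps_mult_nth)
  also have "\<dots> = (\<Sum>i\<in>{0, j}. fps_nth f i * fps_nth g (j - i))"
    using assms by (intro sum.mono_neutral_right) (auto simp: flat_below_def)
  finally show ?thesis using assms by (simp add: flat_below_def)
qed

lemma flat_below_mult:
  assumes "flat_below n f" "flat_below n g" "n > 0"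
  shows "flat_below n (f * g)" "fps_nth (f * g) n = fps_nth f n + fps_nth g n"
  using assms flat_below_mult_nth[OF assms(1), of _ g] by (auto simp: flat_below_def)

text \<open>The series is \<open>(1 - x ^ n) ^ c\<close>: integer induction on \<open>c\<close>
  multiplies by \<open>1 - x ^ n\<close> or by its inverse series \<open>g\<close>.\<close>

lemma exists_flat_fps:
  assumes "n > 0"
  shows "\<exists>G. flat_below n G \<and> fps_nth G n = - c \<and> neg_log_deriv G (fps_const c * multiples_fps n)"
    (is "?P c")
proof -
  have add: "?P (a + b)" if "?P a" "?P b" for a b
  proof -
    obtain G H where GH:
      "flat_below n G" "fps_nth G n = - a" "neg_log_deriv G (fps_const a * multiples_fps n)"
      "flat_below n H" "fps_nth H n = - b" "neg_log_deriv H (fps_const b * multiples_fps n)"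
      using \<open>?P a\<close> \<open>?P b\<close> by blast
    have "neg_log_deriv (G * H) (fps_const (a + b) * multiples_fps n)"
      using neg_log_deriv_mult[OF GH(3,6)] by (simp add: ring_distribs flip: fps_const_add)
    then show ?thesis
      using flat_below_mult[OF GH(1,4) assms] GH by (intro exI[of _ "G * H"]) auto
  qed
  have one: "?P 1"
    using neg_log_deriv_one_minus_X_power[OF assms] assms
    by (intro exI[of _ "1 - fps_X ^ n"]) (auto simp: flat_below_def fps_X_power_nth)
  define g where "g = fps_right_inverse (1 - fps_X ^ n :: int fps) 1"
  have g: "(1 - fps_X ^ n) * g = 1"
    unfolding g_def using assms by (intro fps_right_inverse) (auto simp: fps_X_power_nth)
  have flat: "flat_below n (1 - fps_X ^ n :: int fps)"
    using assms by (auto simp: flat_below_def fps_X_power_nth)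
  have g0: "fps_nth g 0 = 1" by (simp add: g_def)
  have gj: "fps_nth g j = (if j = n then 1 else 0)" if "0 < j" "j \<le> n" for j
    using flat_below_mult_nth[OF flat that, of g] g g0 that assms
    by (auto simp: fps_X_power_nth split: if_splits)
  have minus_one: "?P (- 1)"
    using neg_log_deriv_inverse[OF g neg_log_deriv_one_minus_X_power[OF assms]] assms gj g0
    by (intro exI[of _ g]) (auto simp: flat_below_def simp flip: fps_const_neg)
  show ?thesis
  proof (induction c rule: int_induct[of _ 0])
    case base
    show ?case by (intro exI[of _ 1]) (use assms in \<open>auto simp: flat_below_def neg_log_deriv_def\<close>)
  next
    case (step1 i)
    then show ?case using add[OF _ one] by blast
  next
    case (step2 i)
    then show ?case using add[OF _ minus_one] by fastforce
  qed
qed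

text \<open>A power series with constant term 1 is a product of integer powers of the series
  \<open>1 - x ^ n\<close>, and the sequence belonging to \<open>1 - x ^ n\<close> is \<open>n\<close> on the multiples of \<open>n\<close>.\<close>

lemma dold_if_neg_log_deriv:
  fixes f A :: "int fps"
  assumes "fps_nth f 0 = 1" "neg_log_deriv f A"
  shows "dold (fps_nth A)"
  unfolding dold_def
proof (intro allI impI)
  fix n :: nat assume n: "n \<ge> 1"
  \<comment> \<open>Invariant: \<open>F\<close> is what remains of \<open>f\<close> after powers of
    \<open>1 - x\<close>, ..., \<open>1 - x ^ N\<close> have been split off, \<open>b\<close>
    records their exponents, and \<open>A'\<close> belongs to \<open>F\<close>.\<close>
  have "\<exists>b F A'. flat_below (Suc N) F \<and> neg_log_deriv F A' \<and>
      A = A' + (\<Sum>e=1..N. fps_const (b e) * multiples_fps e)" for N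
  proof (induction N)
    case 0
    show ?case using assms by (intro exI[of _ "\<lambda>_. 0"] exI[of _ f] exI[of _ A]) (auto simp: flat_below_def)
  next
    case (Suc N)
    then obtain b F A' where F: "flat_below (Suc N) F" "neg_log_deriv F A'"
      and A: "A = A' + (\<Sum>e=1..N. fps_const (b e) * multiples_fps e)" by blast
    \<comment> \<open>The factor \<open>G\<close> has coefficient \<open>- c\<close> at
      \<open>N + 1\<close> and cancels that of \<open>F\<close>. As \<open>G\<close> is the power
      with exponent \<open>c\<close>, the exponent split off from \<open>f\<close> is
      \<open>- c\<close>.\<close>
    define c where "c = fps_nth F (Suc N)"
    obtain G where G: "flat_below (Suc N) G" "fps_nth G (Suc N) = - c"
      "neg_log_deriv G (fps_const c * multiples_fps (Suc N))"
      using exists_flat_fps[of "Suc N" c] by auto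
    have "flat_below (Suc (Suc N)) (F * G)"
      using flat_below_mult[OF F(1) G(1)] G(2) by (auto simp: flat_below_def less_Suc_eq c_def)
    moreover have "neg_log_deriv (F * G) (A' + fps_const c * multiples_fps (Suc N))"
      by (rule neg_log_deriv_mult[OF F(2) G(3)])
    moreover have "(\<Sum>e=1..N. fps_const ((b(Suc N := - c)) e) * multiples_fps e) =
        (\<Sum>e=1..N. fps_const (b e) * multiples_fps e)"
      by (intro sum.cong) auto
    then have "A = (A' + fps_const c * multiples_fps (Suc N)) +
        (\<Sum>e=1..Suc N. fps_const ((b(Suc N := - c)) e) * multiples_fps e)"
      by (simp add: A flip: fps_const_neg)
    ultimately show ?case by blast
  qed
  from this[of n] obtain b F A' where F: "flat_below (Suc n) F" "neg_log_deriv F A'"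
    and A: "A = A' + (\<Sum>e=1..n. fps_const (b e) * multiples_fps e)" by blast
  have A'0: "fps_nth A' 0 = 0"
    using arg_cong[OF F(2)[unfolded neg_log_deriv_def], of "\<lambda>f. fps_nth f 0"] F(1)
    by (simp add: flat_below_def)
  \<comment> \<open>\<open>F\<close> agrees with 1 up to degree \<open>n\<close>, so
    \<open>F * A' = - x * F'\<close> has no terms there, and neither has \<open>A'\<close>.\<close>
  have A': "fps_nth A' m = 0" if "0 < m" "m \<le> n" for m
  proof -
    have "fps_nth (F * A') m = 0"
      using F that by (auto simp: neg_log_deriv_def flat_below_def)
    then show ?thesis using flat_below_mult_nth[OF F(1), of m A'] that A'0 by simp
  qed
  show "int n dvd (\<Sum>d | d dvd n. moebius_mu d * fps_nth A (n div d))"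
  proof (rule dvd_moebius_sum_if_divisor_sum)
    show "n > 0" using n by simp
  next
    fix m assume m: "m > 0" "m \<le> n"
    have Am: "fps_nth A m = (\<Sum>e=1..n. b e * (if e dvd m then int e else 0))"
      using m A' by (simp add: A fps_sum_nth multiples_fps_def)
    have "{e. e dvd m} \<subseteq> {1..n}"
      using m by (auto simp: Suc_le_eq intro: dvd_pos_nat[of m] order.trans[OF dvd_imp_le])
    then have "(\<Sum>e=1..n. b e * (if e dvd m then int e else 0)) = (\<Sum>e\<in>{e. e dvd m}. b e * (if e dvd m then int e else 0))"
      by (intro sum.mono_neutral_right) auto
    with Am show "fps_nth A m = (\<Sum>e | e dvd m. int e * b e)" by (simp add: mult.commute)
  qed
qed

text \<open>The reversed polynomial \<open>f\<close>, the product of all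
  \<open>1 - \<beta> * x\<close>, has integer coefficients and constant term 1, so its logarithmic
  derivative exists over the integers. Over the complex numbers the same series has the power sums
  as coefficients.\<close>

lemma dold_power_sums:
  fixes S :: "complex set"
  assumes S: "finite S" and Z: "\<And>i. coeff (\<Prod>\<beta>\<in>S. [:- \<beta>, 1:]) i \<in> \<int>"
  obtains T where "dold T" "\<And>n. n \<ge> 1 \<Longrightarrow> of_int (T n) = (\<Sum>\<beta>\<in>S. \<beta> ^ n)"
proof -
  define f where "f = (\<Prod>\<beta>\<in>S. fps_of_poly [:1, - \<beta>:])"
  have refl1: "reflect_poly [:- \<beta>, 1:] = [:1, - \<beta>:]" for \<beta> :: complex
    by (cases "\<beta> = 0") (auto simp: reflect_poly_def cCons_def)
  have "f = fps_of_poly (reflect_poly (\<Prod>\<beta>\<in>S. [:- \<beta>, 1:]))"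
    by (simp add: f_def fps_of_poly_prod reflect_poly_prod refl1)
  then have "fps_nth f k \<in> \<int>" for k
    using Z by (simp add: coeff_reflect_poly)
  then have "\<forall>k. \<exists>z. fps_nth f k = of_int z" by (auto elim: Ints_cases)
  then obtain h where h: "\<And>k. fps_nth f k = of_int (h k)" by metis
  define fi where "fi = Abs_fps h"
  have f0: "fps_nth f 0 = 1" 
    unfolding f_def using S by (induction S rule: finite_induct) (auto simp: fps_of_poly_pCons)
  then have fi0: "fps_nth fi 0 = 1" using h[of 0] by (simp add: fi_def)
  define A where "A = fps_right_inverse fi 1 * - (fps_X * fps_deriv fi)"
  have "fi * fps_right_inverse fi 1 = 1" using fi0 by (intro fps_right_inverse) auto
  then have rel: "neg_log_deriv fi A"
    unfolding A_def neg_log_deriv_def by (simp add: mult.assoc[symmetric])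
  define P where "P = (\<Sum>\<beta>\<in>S. Abs_fps (\<lambda>n. if n = 0 then 0 else \<beta> ^ n))"
  have "neg_log_deriv (fps_of_poly [:1, - \<beta>:]) (Abs_fps (\<lambda>n. if n = 0 then 0 else \<beta> ^ n))" for \<beta> :: complex
    unfolding neg_log_deriv_def
  proof (rule fps_ext)
    fix k
    show "fps_nth (fps_of_poly [:1, - \<beta>:] * Abs_fps (\<lambda>n. if n = 0 then 0 else \<beta> ^ n)) k =
        fps_nth (- (fps_X * fps_deriv (fps_of_poly [:1, - \<beta>:]))) k"
      by (cases k) (auto simp: fps_of_poly_pCons fps_of_poly_const ring_distribs mult.assoc
          fps_X_mult_nth gr0_conv_Suc)
  qed
  then have "neg_log_deriv f P"
    unfolding f_def P_def by (intro neg_log_deriv_prod S) auto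
  moreover have "neg_log_deriv f (Abs_fps (\<lambda>n. of_int (fps_nth A n)))"
    unfolding neg_log_deriv_def
  proof (rule fps_ext)
    fix k
    have "fps_nth (f * Abs_fps (\<lambda>n. of_int (fps_nth A n))) k = of_int (fps_nth (fi * A) k)"
      by (simp add: fps_mult_nth h fi_def)
    also have "\<dots> = fps_nth (- (fps_X * fps_deriv f)) k"
      using rel by (simp add: neg_log_deriv_def h fi_def)
    finally show "fps_nth (f * Abs_fps (\<lambda>n. of_int (fps_nth A n))) k = fps_nth (- (fps_X * fps_deriv f)) k" .
  qed
  \<comment> \<open>Both series are the negative logarithmic derivative of \<open>f\<close>, and
    \<open>f\<close> can be cancelled.\<close>
  ultimately have "f * P = f * Abs_fps (\<lambda>n. of_int (fps_nth A n))"
    by (simp add: neg_log_deriv_def)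
  moreover have "f \<noteq> 0" using f0 by auto
  ultimately have P: "P = Abs_fps (\<lambda>n. of_int (fps_nth A n))" by simp
  have "of_int (fps_nth A n) = (\<Sum>\<beta>\<in>S. \<beta> ^ n)" if "n \<ge> 1" for n
    using arg_cong[OF P, of "\<lambda>f. fps_nth f n"] that by (simp add: P_def fps_sum_nth)
  then show ?thesis
    using dold_if_neg_log_deriv[OF fi0 rel] by (intro that) auto
qed

section \<open>Frobenius congruences\<close>

text \<open>The inner binomial coefficients are divisible by \<open>p\<close>.\<close>

lemma alg_dvd_frobenius_add:
  assumes p: "prime p" and x: "algebraic_int x" "algebraic_int y"
  shows "alg_dvd p ((x + y) ^ p - (x ^ p + y ^ p))"
proof -
  have "p > 0" using p prime_gt_0_nat by blast
  have "(x + y) ^ p = (\<Sum>k\<le>p. of_nat (p choose k) * x ^ k * y ^ (p - k))"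
    by (rule binomial_ring)
  also have "{..p} = insert 0 (insert p {0<..<p})" by auto
  also have "(\<Sum>k\<in>\<dots>. of_nat (p choose k) * x ^ k * y ^ (p - k)) =
      y ^ p + (x ^ p + (\<Sum>k\<in>{0<..<p}. of_nat (p choose k) * x ^ k * y ^ (p - k)))"
    using \<open>p > 0\<close> by (subst sum.insert; simp)+
  finally have "(x + y) ^ p - (x ^ p + y ^ p) =
      (\<Sum>k\<in>{0<..<p}. (x ^ k * y ^ (p - k)) * of_int (int (p choose k)))"
    by (simp add: algebra_simps)
  also have "alg_dvd p \<dots>"
  proof (intro alg_dvd_sum alg_dvd_mult_left alg_dvd_of_int)
    fix k assume "k \<in> {0<..<p}"
    then have "p dvd (p choose k)" using p by (intro dvd_choose_prime) auto
    then show "int p dvd int (p choose k)" by simp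
  qed (use x \<open>p > 0\<close> in \<open>auto intro!: algebraic_int_add_mult algebraic_int_power\<close>)
  finally show ?thesis .
qed

lemma alg_dvd_frobenius_sum:
  assumes p: "prime p" and "\<And>i. i \<in> I \<Longrightarrow> algebraic_int (f i)"
  shows "alg_dvd p ((\<Sum>i\<in>I. f i) ^ p - (\<Sum>i\<in>I. f i ^ p))"
  using assms(2)
proof (induction I rule: infinite_finite_induct)
  case (insert i I)
  have "alg_dvd p (((f i + sum f I) ^ p - (f i ^ p + sum f I ^ p)) + (sum f I ^ p - (\<Sum>i\<in>I. f i ^ p)))"
    using insert by (intro alg_dvd_add alg_dvd_frobenius_add[OF p] algebraic_int_sum) auto
  then show ?case using insert.hyps by (simp add: algebra_simps)
qed (use prime_gt_0_nat[OF p] in \<open>auto simp: zero_power\<close>)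

lemma alg_dvd_frobenius_diff:
  assumes p: "prime p" and x: "algebraic_int x" "algebraic_int y"
  shows "alg_dvd p ((x ^ p - y ^ p) - (x - y) ^ p)"
  using alg_dvd_frobenius_add[OF p algebraic_int_diff[OF x] x(2)] by (simp add: algebra_simps)

lemma prime_dvd_power_minus_self:
  assumes "prime p"
  shows "int p dvd a ^ p - a"
proof -
  have p: "p > 0" using assms prime_gt_0_nat by blast
  define b where "b = nat (a mod int p)"
  have "[b ^ p = b] (mod p)"
  proof (cases "p dvd b")
    case True
    then have "p dvd b ^ p" using p by (auto intro: dvd_trans dvd_power)
    with True show ?thesis by (meson cong_0_iff cong_sym cong_trans)
  next
    case False
    from cong_scalar_left[OF fermat_theorem[OF assms False], of b]
    show ?thesis using p by (simp add: power_eq_if)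
  qed
  then have "[int b ^ p = int b] (mod int p)" by (metis cong_int_iff of_nat_power)
  moreover have "[a = int b] (mod int p)" using p by (simp add: b_def Cong.cong_def)
  ultimately have "[a ^ p = a] (mod int p)"
    by (meson cong_pow cong_sym cong_trans)
  then show ?thesis by (simp add: cong_iff_dvd_diff)
qed

text \<open>In the Dold sum at \<open>p * k\<close> the divisors \<open>e\<close> and
  \<open>p * e\<close> combine to \<open>moebius_mu e * (A (p * (k div e)) - A (k div e))\<close>.
  The terms with \<open>e \<noteq> 1\<close> are divisible by \<open>p\<close> by induction, as
  \<open>k div e\<close> is smaller than \<open>k\<close> and still prime to
  \<open>p\<close>.\<close>

lemma dold_prime_cong:
  assumes A: "dold A" and p: "prime p" and "\<not> p dvd k"
  shows "int p dvd A (p * k) - A k"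
  using assms(3)
proof (induction k rule: less_induct)
  case (less k)
  have k: "k > 0" using less.prems by (intro Nat.gr0I) auto
  have pp: "p > 0" using p prime_gt_0_nat by blast
  have ndvd: "\<not> p dvd e" if "e dvd k" for e using that less.prems dvd_trans by blast
  have "(\<Sum>e | e dvd p * k. moebius_mu e * A (p * k div e)) =
      (\<Sum>e | e dvd k. moebius_mu e * A (p * k div e)) +
      (\<Sum>e | e dvd k. moebius_mu (p * e) * A (p * k div (p * e)))"
    by (rule sum_divisors_prime_mult[OF p less.prems])
  also have "\<dots> = (\<Sum>e | e dvd k. moebius_mu e * (A (p * (k div e)) - A (k div e)))"
    unfolding sum.distrib[symmetric]
  proof (intro sum.cong refl)
    fix e assume "e \<in> {e. e dvd k}"
    then have e: "e dvd k" by simp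
    show "moebius_mu e * A (p * k div e) + moebius_mu (p * e) * A (p * k div (p * e)) =
        moebius_mu e * (A (p * (k div e)) - A (k div e))"
      using moebius_mu_prime_mult[OF p ndvd[OF e]] e pp
      by (simp add: div_mult_swap algebra_simps)
  qed
  also have "{e. e dvd k} = insert 1 {e. e dvd k \<and> e \<noteq> 1}" by auto
  also have "(\<Sum>e\<in>\<dots>. moebius_mu e * (A (p * (k div e)) - A (k div e))) =
      (A (p * k) - A k) + (\<Sum>e | e dvd k \<and> e \<noteq> 1. moebius_mu e * (A (p * (k div e)) - A (k div e)))"
    using k by (subst sum.insert) (auto simp: moebius_mu_def)
  finally have eq: "(\<Sum>e | e dvd p * k. moebius_mu e * A (p * k div e)) =
      (A (p * k) - A k) + (\<Sum>e | e dvd k \<and> e \<noteq> 1. moebius_mu e * (A (p * (k div e)) - A (k div e)))" .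
  have "int (p * k) dvd (\<Sum>e | e dvd p * k. moebius_mu e * A (p * k div e))"
    using A[unfolded dold_def, rule_format, of "p * k"] k pp by simp
  then have "int p dvd (\<Sum>e | e dvd p * k. moebius_mu e * A (p * k div e))"
    by (metis dvd_mult_left of_nat_mult)
  moreover have "int p dvd (\<Sum>e | e dvd k \<and> e \<noteq> 1. moebius_mu e * (A (p * (k div e)) - A (k div e)))"
  proof (intro dvd_sum dvd_mult)
    fix e assume "e \<in> {e. e dvd k \<and> e \<noteq> 1}"
    then obtain e' where e: "k = e * e'" "e \<noteq> 1" by auto
    then have "e > 0" "e' > 0" using k by auto
    then have "k div e = e'" "e' < k" using e by auto
    moreover have "\<not> p dvd e'" using ndvd[of e'] e by auto
    ultimately show "int p dvd A (p * (k div e)) - A (k div e)" using less.IH by simp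
  qed
  ultimately show ?case unfolding eq by (simp add: dvd_add_left_iff)
qed

text \<open>Modulo \<open>p\<close>, the numbers
  \<open>z \<beta> = u \<beta> ^ p - u \<beta>\<close> have vanishing moments at the points
  \<open>\<beta> ^ p\<close>. A polynomial that vanishes at the other points isolates
  \<open>z \<beta>0\<close>, up to a factor congruent to \<open>\<theta> ^ p\<close>, and
  \<open>\<theta>\<close> divides a nonzero integer, which is prime to all large
  \<open>p\<close>.\<close>

lemma eventually_alg_dvd_frobenius:
  fixes S :: "complex set" and u :: "complex \<Rightarrow> complex" and A :: "nat \<Rightarrow> int"
  assumes S: "finite S" "\<And>\<beta>. \<beta> \<in> S \<Longrightarrow> algebraic_int \<beta>"
    and u: "\<And>\<beta>. \<beta> \<in> S \<Longrightarrow> algebraic_int (u \<beta>)"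
    and A: "\<And>n. n \<ge> 1 \<Longrightarrow> of_int (A n) = (\<Sum>\<beta>\<in>S. u \<beta> * \<beta> ^ n)"
    and "dold A" and \<beta>0: "\<beta>0 \<in> S" "\<beta>0 \<noteq> 0"
  obtains M where "\<And>p. prime p \<Longrightarrow> p > M \<Longrightarrow> alg_dvd p (u \<beta>0 ^ p - u \<beta>0)"
proof -
  \<comment> \<open>\<open>\<beta>0\<close> times the derivative at \<open>\<beta>0\<close> of the
    product of all \<open>x - \<beta>\<close>.\<close>
  define \<theta> where "\<theta> = \<beta>0 * (\<Prod>\<beta>\<in>S - {\<beta>0}. \<beta>0 - \<beta>)"
  have "algebraic_int \<theta>"
    using S \<beta>0 by (auto simp: \<theta>_def intro!: algebraic_int_add_mult algebraic_int_prod algebraic_int_diff)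
  moreover have "\<theta> \<noteq> 0" using S(1) \<beta>0 by (auto simp: \<theta>_def)
  ultimately obtain \<eta> m where \<eta>: "algebraic_int \<eta>" "m \<noteq> 0" "\<eta> * \<theta> = of_int m"
    by (rule algebraic_int_dvd_int)
  \<comment> \<open>Above \<open>card S\<close> every index \<open>k\<close> used below is prime to
    \<open>p\<close>; above \<open>|m|\<close> so is \<open>m\<close>.\<close>
  define M where "M = max (card S) (nat \<bar>m\<bar>)"
  have "alg_dvd p (u \<beta>0 ^ p - u \<beta>0)" if p: "prime p" and pM: "p > M" for p
  proof -
    have pp: "p > 0" using p prime_gt_0_nat by blast
    define z where "z = (\<lambda>\<beta>. u \<beta> ^ p - u \<beta>)"
    have z: "algebraic_int (z \<beta>)" if "\<beta> \<in> S" for \<beta>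
      using u[OF that] by (auto simp: z_def intro!: algebraic_int_diff algebraic_int_power)
    \<comment> \<open>Modulo \<open>p\<close>, Fermat and the additivity of Frobenius make
      \<open>A k\<close> congruent to the sum of \<open>u \<beta> ^ p * \<beta> ^ (p * k)\<close>,
      while the Dold condition makes it congruent to \<open>A (p * k)\<close>, the sum of
      \<open>u \<beta> * \<beta> ^ (p * k)\<close>.\<close>
    have Sk: "alg_dvd p (\<Sum>\<beta>\<in>S. z \<beta> * (\<beta> ^ p) ^ k)" if k: "1 \<le> k" "k \<le> card S" for k
    proof -
      have "\<not> p dvd k" using k pM by (auto simp: M_def dest: dvd_imp_le)
      then have d: "int p dvd A (p * k) - A k" by (rule dold_prime_cong[OF \<open>dold A\<close> p])
      have "(\<Sum>\<beta>\<in>S. (u \<beta> * \<beta> ^ k) ^ p) - (\<Sum>\<beta>\<in>S. u \<beta> * \<beta> ^ (p * k)) = (\<Sum>\<beta>\<in>S. z \<beta> * (\<beta> ^ p) ^ k)"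
        unfolding sum_subtractf[symmetric]
        by (intro sum.cong) (auto simp: z_def power_mult_distrib algebra_simps simp flip: power_mult)
      moreover have "(\<Sum>\<beta>\<in>S. u \<beta> * \<beta> ^ (p * k)) = of_int (A (p * k))"
        using k pp by (subst A) auto
      moreover have "(\<Sum>\<beta>\<in>S. u \<beta> * \<beta> ^ k) = of_int (A k)" using k by (subst A) auto
      moreover have "alg_dvd p ((\<Sum>\<beta>\<in>S. u \<beta> * \<beta> ^ k) ^ p - (\<Sum>\<beta>\<in>S. (u \<beta> * \<beta> ^ k) ^ p))"
        using S u by (intro alg_dvd_frobenius_sum[OF p]) (auto intro!: algebraic_int_add_mult algebraic_int_power)
      ultimately have "alg_dvd p (of_int (A k ^ p) - (of_int (A (p * k)) + (\<Sum>\<beta>\<in>S. z \<beta> * (\<beta> ^ p) ^ k)))"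
        by (simp add: diff_eq_eq add.commute)
      from alg_dvd_diff[OF alg_dvd_of_int[OF dvd_diff[OF prime_dvd_power_minus_self[OF p, of "A k"] d] pp] this]
      show ?thesis by (simp add: algebra_simps)
    qed
    \<comment> \<open>The factor \<open>x\<close> removes the moment \<open>k = 0\<close>, about
      which the Dold condition says nothing. It costs a factor \<open>\<beta>0 ^ p\<close>, whence
      \<open>\<beta>0 \<noteq> 0\<close>.\<close>
    define h where "h = [:0, 1:] * (\<Prod>\<beta>\<in>S - {\<beta>0}. [:- (\<beta> ^ p), 1:])"
    have hcoeff: "algebraic_int (coeff h k)" for k
    proof -
      have "algebraic_int (coeff [:- 0, 1 :: complex:] k)" for k by (rule algebraic_int_coeff_linear) simp
      then show ?thesis
        using S unfolding h_def
        by (intro algebraic_int_coeff_mult algebraic_int_coeff_prod algebraic_int_coeff_linear algebraic_int_power) auto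
    qed
    have h0: "coeff h 0 = 0" by (simp add: h_def)
    have hdeg: "degree h \<le> card S"
    proof -
      have "degree h \<le> 1 + degree (\<Prod>\<beta>\<in>S - {\<beta>0}. [:- (\<beta> ^ p), 1:])"
        unfolding h_def by (rule order.trans[OF degree_mult_le]) simp
      also have "degree (\<Prod>\<beta>\<in>S - {\<beta>0}. [:- (\<beta> ^ p), 1:]) = card (S - {\<beta>0})"
        by (subst degree_prod_sum_eq) auto
      also have "1 + card (S - {\<beta>0}) = card S" using card.remove[OF S(1) \<beta>0(1)] by simp
      finally show ?thesis .
    qed
    have "alg_dvd p (\<Sum>k\<le>degree h. coeff h k * (\<Sum>\<beta>\<in>S. z \<beta> * (\<beta> ^ p) ^ k))"
    proof (rule alg_dvd_sum)
      fix k assume "k \<in> {..degree h}"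
      then show "alg_dvd p (coeff h k * (\<Sum>\<beta>\<in>S. z \<beta> * (\<beta> ^ p) ^ k))"
        using h0 hdeg hcoeff Sk by (cases "k = 0") (auto intro!: alg_dvd_mult_left)
    qed
    also have "(\<Sum>k\<le>degree h. coeff h k * (\<Sum>\<beta>\<in>S. z \<beta> * (\<beta> ^ p) ^ k)) =
        (\<Sum>\<beta>\<in>S. z \<beta> * poly h (\<beta> ^ p))"
      unfolding poly_altdef sum_distrib_left by (subst sum.swap) (simp add: mult_ac)
    also have "\<dots> = (\<Sum>\<beta>\<in>{\<beta>0}. z \<beta> * poly h (\<beta> ^ p))"
      using S(1) \<beta>0 by (intro sum.mono_neutral_right) (auto simp: h_def poly_prod)
    also have "\<dots> = z \<beta>0 * (\<beta>0 ^ p * (\<Prod>\<beta>\<in>S - {\<beta>0}. \<beta>0 ^ p - \<beta> ^ p))"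
      by (simp add: h_def poly_prod)
    finally have 1: "alg_dvd p (z \<beta>0 * (\<beta>0 ^ p * (\<Prod>\<beta>\<in>S - {\<beta>0}. \<beta>0 ^ p - \<beta> ^ p)))" .
    \<comment> \<open>Frobenius replaces each \<open>\<beta>0 ^ p - \<beta> ^ p\<close> by
      \<open>(\<beta>0 - \<beta>) ^ p\<close>, so that the factor beside \<open>z \<beta>0\<close>
      becomes \<open>\<theta> ^ p\<close>.\<close>
    have "alg_dvd p ((\<Prod>\<beta>\<in>S - {\<beta>0}. \<beta>0 ^ p - \<beta> ^ p) - (\<Prod>\<beta>\<in>S - {\<beta>0}. (\<beta>0 - \<beta>) ^ p))"
      using S \<beta>0 by (intro alg_dvd_prod_diff conjI alg_dvd_frobenius_diff[OF p] algebraic_int_diff algebraic_int_power) auto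
    then have "alg_dvd p ((z \<beta>0 * \<beta>0 ^ p) * ((\<Prod>\<beta>\<in>S - {\<beta>0}. \<beta>0 ^ p - \<beta> ^ p) - (\<Prod>\<beta>\<in>S - {\<beta>0}. (\<beta>0 - \<beta>) ^ p)))"
      using S \<beta>0 z by (intro alg_dvd_mult_left algebraic_int_add_mult algebraic_int_power) auto
    from alg_dvd_diff[OF 1 this] have "alg_dvd p (z \<beta>0 * \<theta> ^ p)"
      by (simp add: \<theta>_def prod_power_distrib power_mult_distrib algebra_simps)
    then have "alg_dvd p (\<eta> ^ p * (z \<beta>0 * \<theta> ^ p))"
      by (rule alg_dvd_mult_left[OF algebraic_int_power[OF \<eta>(1)]])
    also have "\<eta> ^ p * (z \<beta>0 * \<theta> ^ p) = (\<eta> * \<theta>) ^ p * z \<beta>0" by (simp add: power_mult_distrib)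
    also have "\<dots> = of_int (m ^ p) * z \<beta>0" by (simp add: \<eta>(3))
    finally have "alg_dvd p (of_int (m ^ p) * z \<beta>0)" .
    moreover have "Rings.coprime (m ^ p) (int p)"
    proof -
      have "\<not> int p dvd m" using pM \<eta>(2) zdvd_imp_le[of "int p" "\<bar>m\<bar>"] by (auto simp: M_def)
      then show ?thesis using p prime_imp_coprime[of "int p" m] by (auto simp: coprime_commute)
    qed
    ultimately show ?thesis using alg_dvd_cancel_coprime[of "m ^ p" p "z \<beta>0"] pp z[OF \<beta>0(1)]
      by (simp add: z_def)
  qed
  then show ?thesis by (rule that)
qed

section \<open>Falling factorials modulo primes\<close>

lemma dvd_coeff_if_dvd_values:
  fixes h :: "int poly"
  assumes p: "prime p" and "n \<le> p" "\<And>i. i \<ge> n \<Longrightarrow> coeff h i = 0" "\<And>a. a < n \<Longrightarrow> int p dvd poly h (int a)"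
  shows "int p dvd coeff h i"
  using assms(2-4)
proof (induction n arbitrary: h i)
  case (Suc n)
  \<comment> \<open>Splitting off the point \<open>n\<close> leaves a remainder divisible by
    \<open>p\<close> and a quotient whose values at all \<open>a < n\<close> are divisible by
    \<open>p\<close>, because \<open>a - n\<close> is a unit modulo \<open>p\<close>.\<close>
  define g where "g = synthetic_div h (int n)"
  have h: "h = [:- int n, 1:] * g + [:poly h (int n):]"
    unfolding g_def by (rule synthetic_div_correct'[symmetric])
  have "int p dvd coeff g i" for i
  proof (rule Suc.IH)
    show "n \<le> p" using Suc.prems by simp
  next
    fix i assume "n \<le> i"
    moreover have "degree h \<le> n" using Suc.prems(2) by (intro degree_le) auto
    ultimately show "coeff g i = 0"
    proof (cases "n = 0")
      \<comment> \<open>Here the truncated \<open>degree h - 1\<close> gives no bound below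
        \<open>n\<close>, but \<open>h\<close> is constant.\<close>
      case True
      then have "g = 0" using \<open>degree h \<le> n\<close> by (simp add: g_def synthetic_div_eq_0_iff)
      then show ?thesis by simp
    qed (auto simp: g_def degree_synthetic_div intro!: coeff_eq_0)
  next
    fix a assume a: "a < n"
    have "poly h (int a) = (int a - int n) * poly g (int a) + poly h (int n)"
      by (subst h) (simp add: algebra_simps)
    moreover have "int p dvd poly h (int a)" "int p dvd poly h (int n)"
      using Suc.prems(3) a by auto
    ultimately have "int p dvd (int a - int n) * poly g (int a)"
      by (metis dvd_add_left_iff)
    moreover have "\<not> int p dvd int a - int n"
    proof
      assume "int p dvd int a - int n"
      then have "int p dvd int (n - a)" using a by (simp add: of_nat_diff dvd_diff_commute)
      then have "p dvd n - a" by simp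
      then show False using a Suc.prems(1) by (auto dest: dvd_imp_le)
    qed
    ultimately show "int p dvd poly g (int a)"
      using p by (simp add: prime_dvd_mult_iff)
  qed
  moreover have "int p dvd poly h (int n)" using Suc.prems(3) by simp
  ultimately show ?case
    by (subst h) (auto simp: coeff_pCons split: nat.splits)
qed auto

text \<open>As polynomials modulo \<open>p\<close>, the product of all \<open>X - j\<close> is
  \<open>X ^ p - X\<close>: the difference \<open>h\<close> has degree below \<open>p\<close> and by
  Fermat vanishes modulo \<open>p\<close> at every residue.\<close>

lemma alg_dvd_prod_residues:
  assumes p: "prime p" and x: "algebraic_int x" and d: "alg_dvd p (x ^ p - x)"
  shows "alg_dvd p (\<Prod>j<p. x - of_nat j)"
proof -
  have p1: "p > 1" using p prime_gt_1_nat by blast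
  define f where "f = (\<Prod>j<p. [:- int j, 1:])"
  define h where "h = f - (monom 1 p - [:0, 1:])"
  have degf: "degree f = p" unfolding f_def by (subst degree_prod_sum_eq) auto
  have "lead_coeff f = 1" unfolding f_def by (simp add: lead_coeff_prod)
  then have "coeff h i = 0" if "i \<ge> p" for i
    using that p1 degf by (cases "i = p") (auto simp: h_def coeff_pCons coeff_eq_0 split: nat.splits)
  moreover have "int p dvd poly h (int a)" if "a < p" for a
  proof -
    have "poly f (int a) = 0" using that by (auto simp: f_def poly_prod)
    then have "poly h (int a) = - (int a ^ p - int a)" by (simp add: h_def poly_monom)
    then show ?thesis using prime_dvd_power_minus_self[OF p, of "int a"] by (simp only: dvd_minus_iff)
  qed
  ultimately have hc: "int p dvd coeff h i" for i
    by (intro dvd_coeff_if_dvd_values[OF p order.refl])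
  have "poly (map_poly of_int h) x = (\<Sum>i\<le>degree h. x ^ i * of_int (coeff h i))"
    by (simp add: poly_altdef coeff_map_poly mult.commute)
  also have "alg_dvd p \<dots>"
    using hc p1 x by (intro alg_dvd_sum alg_dvd_mult_left alg_dvd_of_int algebraic_int_power) auto
  finally have 1: "alg_dvd p (poly (map_poly of_int h) x)" .
  have "map_poly of_int f = (\<Prod>j<p. [:- of_nat j, 1 :: complex:])"
    unfolding f_def by (simp add: of_int_poly_hom.hom_prod)
  then have "poly (map_poly of_int h) x = (\<Prod>j<p. x - of_nat j) - (x ^ p - x)"
    by (simp add: h_def of_int_poly_hom.hom_minus poly_prod poly_monom map_poly_monom)
  then show ?thesis using alg_dvd_add[OF 1 d] by simp
qed

text \<open>Frobenius is additive and multiplicative modulo \<open>p\<close>, and it fixes integers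
  by Fermat's theorem.\<close>

lemma alg_dvd_frobenius_affine:
  assumes p: "prime p" and u: "algebraic_int u" "alg_dvd p (u ^ p - u)"
  shows "alg_dvd p ((of_int a + of_int b * u) ^ p - (of_int a + of_int b * u))"
proof -
  have pp: "p > 0" using p prime_gt_0_nat by blast
  have "alg_dvd p ((of_int a + of_int b * u) ^ p - (of_int a ^ p + (of_int b * u) ^ p))"
    using u by (intro alg_dvd_frobenius_add[OF p] algebraic_int_add_mult) auto
  moreover have "alg_dvd p (of_int (a ^ p - a))" "alg_dvd p (of_int (b ^ p - b))"
    using prime_dvd_power_minus_self[OF p] pp by (auto intro!: alg_dvd_of_int simp del: of_int_diff)
  moreover have "alg_dvd p (u ^ p * of_int (b ^ p - b))" "alg_dvd p (of_int b * (u ^ p - u))"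
    using calculation u by (auto intro!: alg_dvd_mult_left algebraic_int_power simp del: of_int_diff)
  ultimately have "alg_dvd p (((of_int a + of_int b * u) ^ p - (of_int a ^ p + (of_int b * u) ^ p))
      + of_int (a ^ p - a) + (u ^ p * of_int (b ^ p - b)) + (of_int b * (u ^ p - u)))"
    by (intro alg_dvd_add)
  then show ?thesis by (simp add: power_mult_distrib algebra_simps)
qed

text \<open>The product contains \<open>k div p\<close> blocks of \<open>p\<close> consecutive
  factors. Each block is an instance of \<open>alg_dvd_prod_residues\<close> at a shift of
  \<open>w\<close>, which satisfies the same congruence.\<close>

lemma alg_dvd_falling_product:
  assumes p: "prime p" and "algebraic_int w" "alg_dvd p (w ^ p - w)"
  shows "alg_dvd (p ^ (k div p)) (\<Prod>j<k. w - of_nat j)"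
  using assms(2,3)
proof (induction k arbitrary: w rule: less_induct)
  case (less k)
  have pp: "p > 0" using p prime_gt_0_nat by blast
  show ?case
  proof (cases "k < p")
    case True
    then show ?thesis
      using less.prems by (auto simp: alg_dvd_1[unfolded One_nat_def] intro!: algebraic_int_prod algebraic_int_diff)
  next
    case False
    have "alg_dvd p ((of_int (- int p) + of_int 1 * w) ^ p - (of_int (- int p) + of_int 1 * w))"
      by (rule alg_dvd_frobenius_affine[OF p less.prems])
    then have IH: "alg_dvd (p ^ ((k - p) div p)) (\<Prod>j<k - p. (w - of_nat p) - of_nat j)"
      using less.prems pp False by (intro less.IH) (auto intro: algebraic_int_diff)
    have "(\<lambda>j. p + j) ` {..<k - p} = {p..<k}"
      using False by (simp add: lessThan_atLeast0 image_add_atLeastLessThan)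
    then have "{..<k} = {..<p} \<union> (\<lambda>j. p + j) ` {..<k - p}"
      using False by (simp add: ivl_disj_un)
    moreover have "{..<p} \<inter> (\<lambda>j. p + j) ` {..<k - p} = {}" by auto
    ultimately have "(\<Prod>j<k. w - of_nat j) = (\<Prod>j<p. w - of_nat j) * (\<Prod>j<k - p. (w - of_nat p) - of_nat j)"
      by (simp add: prod.union_disjoint prod.reindex diff_diff_eq)
    moreover have "k div p = Suc ((k - p) div p)" using False pp by (simp add: le_div_geq)
    ultimately show ?thesis
      using alg_dvd_mult[OF alg_dvd_prod_residues[OF p less.prems] IH] by simp
  qed
qed

text \<open>Legendre's formula for \<open>k!\<close>, restricted to primes above \<open>M\<close> and cut off after its first term:
  the higher terms only contribute a factor exponential in \<open>k\<close>.\<close>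

definition prime_part_factorial :: "nat \<Rightarrow> nat \<Rightarrow> nat" where
  "prime_part_factorial M k = (\<Prod>p | prime p \<and> M < p \<and> p \<le> k. p ^ (k div p))"

lemma prime_part_factorial_pos: "prime_part_factorial M k > 0"
  unfolding prime_part_factorial_def by (intro prod_pos) (auto simp: prime_gt_0_nat)

lemma alg_dvd_prime_part_factorial:
  assumes "algebraic_int w" "\<And>p. prime p \<Longrightarrow> p > M \<Longrightarrow> alg_dvd p (w ^ p - w)"
  shows "alg_dvd (prime_part_factorial M k) (\<Prod>j<k. w - of_nat j)"
  unfolding prime_part_factorial_def
proof (rule alg_dvd_prod_coprime)
  show "alg_dvd 1 (\<Prod>j<k. w - of_nat j)"
    using assms(1) unfolding alg_dvd_1 by (intro algebraic_int_prod algebraic_int_diff) auto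
  fix p assume "p \<in> {p. prime p \<and> M < p \<and> p \<le> k}"
  then show "alg_dvd (p ^ (k div p)) (\<Prod>j<k. w - of_nat j) \<and> p ^ (k div p) > 0"
    using alg_dvd_falling_product[OF _ assms(1) assms(2)] by (auto simp: prime_gt_0_nat)
qed (auto simp: primes_coprime)

section \<open>Size of the prime part of factorials\<close>

text \<open>Only the multiples of \<open>p\<close> among \<open>1\<close>, ..., \<open>k\<close>
  contribute, and dividing each of them by \<open>p\<close> leaves \<open>1\<close>, ...,
  \<open>k div p\<close>.\<close>

lemma multiplicity_fact_rec:
  assumes p: "prime (p::nat)"
  shows "multiplicity p (fact k) = k div p + multiplicity p (fact (k div p))"
proof -
  have pp: "p > 0" using p prime_gt_0_nat by blast
  have fact: "multiplicity p (fact n) = (\<Sum>j\<in>{1..n}. multiplicity p j)" for n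
    unfolding fact_prod of_nat_id using p by (subst prime_elem_multiplicity_prod_distrib) auto
  have img: "{j \<in> {1..k}. p dvd j} = (*) p ` {1..k div p}"
  proof (intro equalityI subsetI)
    fix j assume "j \<in> {j \<in> {1..k}. p dvd j}"
    then obtain i where "j = p * i" "1 \<le> j" "j \<le> k" by auto
    then show "j \<in> (*) p ` {1..k div p}"
      using pp by (auto simp: less_eq_div_iff_mult_less_eq mult.commute)
  qed (use pp in \<open>auto simp: less_eq_div_iff_mult_less_eq mult.commute\<close>)
  have "(\<Sum>j\<in>{1..k}. multiplicity p j) = (\<Sum>j\<in>{j \<in> {1..k}. p dvd j}. multiplicity p j)"
    by (intro sum.mono_neutral_right) (auto simp: not_dvd_imp_multiplicity_0)
  also have "\<dots> = (\<Sum>i\<in>{1..k div p}. multiplicity p (p * i))"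
    unfolding img using pp by (subst sum.reindex) (auto simp: inj_on_def)
  also have "\<dots> = (\<Sum>i\<in>{1..k div p}. 1 + multiplicity p i)"
    using p by (intro sum.cong) (auto simp: prime_elem_multiplicity_mult_distrib not_prime_unit)
  finally show ?thesis by (simp add: fact sum_Suc)
qed

text \<open>Induction along the recursion, as \<open>(p - 1) * t + t = t * p \<le> k\<close> for
  \<open>t = k div p\<close>.\<close>

lemma multiplicity_fact_le:
  assumes p: "prime (p::nat)"
  shows "(p - 1) * multiplicity p (fact k) \<le> k"
proof (induction k rule: less_induct)
  case (less k)
  have p1: "p > 1" using p prime_gt_1_nat by blast
  show ?case
  proof (cases "k = 0")
    case False
    define t where "t = k div p"
    have "t < k" using False p1 by (simp add: t_def)
    then have IH: "(p - 1) * multiplicity p (fact t) \<le> t" by (rule less)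
    have "(p - 1) * multiplicity p (fact k) = (p - 1) * t + (p - 1) * multiplicity p (fact t)"
      by (subst multiplicity_fact_rec[OF p]) (simp add: t_def ring_distribs)
    also have "\<dots> \<le> (p - 1) * t + t" using IH by simp
    also have "\<dots> = t * p" using p1 by (simp add: algebra_simps)
    also have "\<dots> \<le> k" by (simp add: t_def)
    finally show ?thesis .
  qed simp
qed

text \<open>Beyond its first Legendre term a prime \<open>p\<close> contributes at most
  \<open>k * ln p / (p * (p - 1))\<close>, and these bounds form a convergent series. The first
  terms of the primes up to \<open>M\<close> contribute at most \<open>k\<close> times the sum of
  their logarithms.\<close>

lemma ln_fact_le_prime_part_factorial:
  obtains c where "\<And>k. ln (fact k) \<le> c * real k + ln (real (prime_part_factorial M k))"
proof -
  define f where "f = (\<lambda>n::nat. ln (real n) / (real n * (real n - 1)))"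
  have sf: "summable f"
  \<comment> \<open>The differences of \<open>1 / sqrt n\<close> telescope and have order
    \<open>1 / n powr (3 / 2)\<close>, which dominates \<open>ln n / n ^ 2\<close>.\<close>
  proof (rule summable_comparison_test_bigo)
    have "(\<lambda>n. 1 / sqrt (real n)) \<longlonglongrightarrow> 0" by real_asymp
    then have "summable (\<lambda>n. 1 / sqrt (real n) - 1 / sqrt (real (Suc n)))"
      by (rule telescope_summable')
    then show "summable (\<lambda>n. norm (1 / sqrt (real (Suc n)) - 1 / sqrt (real (Suc (Suc n)))))"
      by (subst (asm) summable_Suc_iff[symmetric]) (simp add: frac_le)
    show "f \<in> O(\<lambda>n. 1 / sqrt (real (Suc n)) - 1 / sqrt (real (Suc (Suc n))))" unfolding f_def by real_asymp
  qed
  have fnn: "f n \<ge> 0" for n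
    by (cases "n = 0") (auto simp: f_def intro!: divide_nonneg_nonneg mult_nonneg_nonneg)
  define c where "c = suminf f + (\<Sum>p\<in>{1..M}. ln (real p))"
  have "ln (fact k) \<le> c * real k + ln (real (prime_part_factorial M k))" for k
  proof -
    define P where "P = {p \<in> {2..k}. prime p}"
    have fin: "finite P" by (simp add: P_def)
    have "fact k = (\<Prod>p\<in>P. p ^ multiplicity p (fact k :: nat))"
      using prime_factorization_nat[of "fact k"] by (simp add: prime_factors_fact P_def)
    then have "ln (fact k) = ln (real (\<Prod>p\<in>P. p ^ multiplicity p (fact k :: nat)))"
      by (metis of_nat_fact)
    also have "\<dots> = (\<Sum>p\<in>P. ln (real p ^ multiplicity p (fact k :: nat)))"
      unfolding of_nat_prod of_nat_power using fin by (intro ln_prod) (auto simp: P_def)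
    also have "\<dots> = (\<Sum>p\<in>P. real (multiplicity p (fact k :: nat)) * ln (real p))"
      by (intro sum.cong) (auto simp: P_def ln_realpow)
    also have "\<dots> \<le> (\<Sum>p\<in>P. real (k div p) * ln (real p) + real k * f p)"
    proof (rule sum_mono)
      fix p assume "p \<in> P"
      then have p: "prime p" "p \<ge> 2" by (auto simp: P_def)
      define t where "t = k div p"
      have "real ((p - 1) * multiplicity p (fact t)) \<le> real t"
        using multiplicity_fact_le[OF p(1), of t] by (simp only: of_nat_le_iff)
      then have "real (multiplicity p (fact t :: nat)) \<le> real t / (real p - 1)"
        using p(2) by (simp add: field_simps of_nat_diff)
      also have "\<dots> \<le> (real k / real p) / (real p - 1)"
        using p(2) by (intro divide_right_mono) (auto simp: t_def of_nat_div_le_of_nat)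
      finally have "real (multiplicity p (fact k :: nat)) \<le> real t + real k / (real p * (real p - 1))"
        using multiplicity_fact_rec[OF p(1), of k] by (simp add: t_def)
      then have "real (multiplicity p (fact k :: nat)) * ln (real p) \<le> (real t + real k / (real p * (real p - 1))) * ln (real p)"
        using p(2) by (intro mult_right_mono) auto
      then show "real (multiplicity p (fact k :: nat)) * ln (real p) \<le> real (k div p) * ln (real p) + real k * f p"
        by (simp add: f_def t_def ring_distribs)
    qed
    also have "\<dots> = (\<Sum>p\<in>P. real (k div p) * ln (real p)) + real k * (\<Sum>p\<in>P. f p)"
      by (simp add: sum.distrib sum_distrib_left)
    also have "(\<Sum>p\<in>P. f p) \<le> suminf f"
      by (rule sum_le_suminf[OF sf fin]) (use fnn in auto)
    also have "(\<Sum>p\<in>P. real (k div p) * ln (real p)) =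
        (\<Sum>p\<in>{p \<in> P. M < p}. real (k div p) * ln (real p)) + (\<Sum>p\<in>{p \<in> P. p \<le> M}. real (k div p) * ln (real p))"
      using fin by (subst sum.union_disjoint[symmetric]) (auto intro!: sum.cong)
    also have "(\<Sum>p\<in>{p \<in> P. p \<le> M}. real (k div p) * ln (real p)) \<le> (\<Sum>p\<in>{p \<in> P. p \<le> M}. real k * ln (real p))"
      by (intro sum_mono mult_right_mono) (auto simp: P_def)
    also have "\<dots> \<le> (\<Sum>p\<in>{1..M}. real k * ln (real p))"
      by (rule sum_mono2) (auto simp: P_def)
    also have "\<dots> = real k * (\<Sum>p\<in>{1..M}. ln (real p))" by (simp add: sum_distrib_left)
    also have "(\<Sum>p\<in>{p \<in> P. M < p}. real (k div p) * ln (real p)) = ln (real (prime_part_factorial M k))"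
    proof -
      have "{p \<in> P. M < p} = {p. prime p \<and> M < p \<and> p \<le> k}" by (auto simp: P_def prime_ge_2_nat)
      moreover have "ln (\<Prod>p\<in>{p \<in> P. M < p}. real p ^ (k div p)) = (\<Sum>p\<in>{p \<in> P. M < p}. ln (real p ^ (k div p)))"
        using fin by (intro ln_prod) (auto simp: P_def)
      moreover have "\<dots> = (\<Sum>p\<in>{p \<in> P. M < p}. real (k div p) * ln (real p))"
        by (intro sum.cong) (auto simp: P_def ln_realpow)
      ultimately show ?thesis by (simp add: prime_part_factorial_def)
    qed
    finally show ?thesis by (simp add: c_def algebra_simps mult_right_mono)
  qed
  then show ?thesis by (rule that)
qed

text \<open>The bound \<open>k! \<ge> (k / e) ^ k\<close>, by induction from
  \<open>ln (1 + 1 / k) \<le> 1 / k\<close>.\<close>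

lemma ln_fact_ge: "ln (fact k) \<ge> real k * ln (real k) - real k"
proof (induction k)
  case (Suc k)
  show ?case
  proof (cases "k = 0")
    case False
    have "ln (real (Suc k) / real k) \<le> real (Suc k) / real k - 1"
      using False by (intro ln_le_minus_one) auto
    moreover have "ln (real (Suc k) / real k) = ln (real (Suc k)) - ln (real k)"
      using False by (intro ln_divide_pos) auto
    moreover have "real (Suc k) / real k - 1 = 1 / real k" using False by (simp add: field_simps)
    ultimately have "ln (real (Suc k)) - ln (real k) \<le> 1 / real k" by linarith
    then have "real k * (ln (real (Suc k)) - ln (real k)) \<le> real k * (1 / real k)"
      by (intro mult_left_mono) auto
    then have "real k * (ln (real (Suc k)) - ln (real k)) \<le> 1" using False by simp
    moreover have "ln (fact (Suc k)) = ln (real (Suc k)) + ln (fact k)"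
      by (simp add: ln_mult del: of_nat_Suc)
    ultimately show ?thesis using Suc by (simp add: algebra_simps)
  qed simp
qed simp

lemma ln_fact_le: "ln (fact k) \<le> real k * ln (real k)"
proof (cases "k = 0")
  case False
  have "ln (fact k) \<le> ln (real k ^ k)"
    using False fact_le_power[of k, where ?'a = real] by (subst ln_le_cancel_iff) auto
  also have "\<dots> = real k * ln (real k)" using False by (simp add: ln_realpow)
  finally show ?thesis .
qed simp

text \<open>Only the upper half \<open>H \<le> k < 2 * H\<close> is kept, with \<open>ln k\<close>
  bounded below by \<open>ln H\<close>. For \<open>N = 2 * H\<close> the leading term is
  \<open>3 / 8 * N ^ 2 * ln N\<close>, which is enough against the upper bound
  \<open>1 / 4 * N ^ 2 * ln N\<close> for the determinant.\<close>

lemma sum_ln_fact_ge: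
  assumes "H \<ge> 3"
  shows "(\<Sum>k<2 * H. ln (fact k)) \<ge> (ln (real H) - 1) * (real H * (3 * real H - 1) / 2)"
proof -
  have H: "ln (real H) \<ge> 1"
    using assms exp_le by (subst ln_ge_iff) auto
  have sum: "(\<Sum>k=H..<2 * H. real k) = real H * (3 * real H - 1) / 2"
  proof -
    have g: "(\<Sum>k<n. real k) = real n * (real n - 1) / 2" for n
      by (induction n) (auto simp: field_simps)
    have "{..<2 * H} = {..<H} \<union> {H..<2 * H}" by auto
    then have "(\<Sum>k<2 * H. real k) = (\<Sum>k<H. real k) + (\<Sum>k=H..<2 * H. real k)"
      by (simp add: sum.union_disjoint ivl_disj_int)
    then show ?thesis unfolding g by (simp add: field_simps)
  qed
  have "(ln (real H) - 1) * (real H * (3 * real H - 1) / 2) = (\<Sum>k=H..<2 * H. (ln (real H) - 1) * real k)"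
    by (simp add: sum[symmetric] sum_distrib_left)
  also have "\<dots> \<le> (\<Sum>k=H..<2 * H. ln (fact k))"
  proof (rule sum_mono)
    fix k assume k: "k \<in> {H..<2 * H}"
    have "(ln (real H) - 1) * real k \<le> (ln (real k) - 1) * real k"
      using k assms by (intro mult_right_mono) auto
    also have "\<dots> \<le> ln (fact k)" using ln_fact_ge[of k] by (simp add: algebra_simps)
    finally show "(ln (real H) - 1) * real k \<le> ln (fact k)" .
  qed
  also have "\<dots> \<le> (\<Sum>k<2 * H. ln (fact k))"
    by (rule sum_mono2) auto
  finally show ?thesis .
qed

lemma exists_factorial_product_large:
  fixes D B :: real
  assumes "D > 0" "B > 0"
  obtains L where "L > 0"
    "D * fact (L\<^sup>2) * (real L * B) ^ (\<Sum>k<L\<^sup>2. k) < real (\<Prod>k<L\<^sup>2. prime_part_factorial M k)"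
proof -
  obtain c where c: "\<And>k. ln (fact k) \<le> c * real k + ln (real (prime_part_factorial M k))"
    using ln_fact_le_prime_part_factorial[of M] by metis
  \<comment> \<open>The constant \<open>c\<close> of the factorial estimate and \<open>ln B\<close>
    are both multiplied by the sum of all \<open>k < N\<close>.\<close>
  define K where "K = ln B + c"
  define d where "d = ln D"
  \<comment> \<open>The leading terms are \<open>8 * m ^ 4 * ln m\<close> on the left and
    \<open>12 * m ^ 4 * ln m\<close> on the right.\<close>
  have "eventually (\<lambda>m::nat. d + (4 * real m ^ 2) * ln (4 * real m ^ 2) +
      (4 * real m ^ 2) * (4 * real m ^ 2 - 1) / 2 * (ln (2 * real m) + K) <
      (ln (2 * real m ^ 2) - 1) * (2 * real m ^ 2 * (3 * (2 * real m ^ 2) - 1) / 2)) at_top"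
    by real_asymp
  then have "eventually (\<lambda>m::nat. m \<ge> 2 \<and> d + (4 * real m ^ 2) * ln (4 * real m ^ 2) +
      (4 * real m ^ 2) * (4 * real m ^ 2 - 1) / 2 * (ln (2 * real m) + K) <
      (ln (2 * real m ^ 2) - 1) * (2 * real m ^ 2 * (3 * (2 * real m ^ 2) - 1) / 2)) at_top"
    using eventually_ge_at_top[of 2] by eventually_elim auto
  then obtain m :: nat where m: "m \<ge> 2" and ineq: "d + (4 * real m ^ 2) * ln (4 * real m ^ 2) +
      (4 * real m ^ 2) * (4 * real m ^ 2 - 1) / 2 * (ln (2 * real m) + K) <
      (ln (2 * real m ^ 2) - 1) * (2 * real m ^ 2 * (3 * (2 * real m ^ 2) - 1) / 2)"
    by (auto simp: eventually_at_top_linorder)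
  \<comment> \<open>An even \<open>L\<close> makes \<open>N\<close> even, as the split into two
    halves of length \<open>H\<close> requires.\<close>
  define L N H where "L = 2 * m" and "N = L\<^sup>2" and "H = 2 * m\<^sup>2"
  have L: "L > 0" and NH: "N = 2 * H" and N: "real N = 4 * real m ^ 2" and H: "real H = 2 * real m ^ 2"
    using m by (auto simp: L_def N_def H_def power2_eq_square)
  have H3: "H \<ge> 3"
    using mult_mono[OF m m] m by (simp add: H_def power2_eq_square)
  have sumk: "real (\<Sum>k<N. k) = real N * (real N - 1) / 2"
    by (induction N) (auto simp: field_simps)
  have "ln (D * fact N * (real L * B) ^ (\<Sum>k<N. k)) =
      d + ln (fact N) + real (\<Sum>k<N. k) * (ln (real L) + ln B)"
    using assms L by (simp add: ln_mult ln_realpow d_def del: of_nat_sum)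
  also have "\<dots> \<le> d + real N * ln (real N) + real (\<Sum>k<N. k) * (ln (real L) + ln B)"
    using ln_fact_le[of N] by simp
  also have "\<dots> = (d + real N * ln (real N) + real N * (real N - 1) / 2 * (ln (real L) + K)) - c * real (\<Sum>k<N. k)"
    unfolding sumk K_def by (simp add: algebra_simps)
  also have "d + real N * ln (real N) + real N * (real N - 1) / 2 * (ln (real L) + K) <
      (ln (real H) - 1) * (real H * (3 * real H - 1) / 2)"
    using ineq unfolding N H L_def by simp
  also have "\<dots> \<le> (\<Sum>k<N. ln (fact k))"
    using sum_ln_fact_ge[OF H3] NH by simp
  also have "\<dots> \<le> (\<Sum>k<N. c * real k + ln (real (prime_part_factorial M k)))"
    by (intro sum_mono c)
  also have "\<dots> = c * real (\<Sum>k<N. k) + (\<Sum>k<N. ln (real (prime_part_factorial M k)))"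
    by (simp add: sum.distrib sum_distrib_left)
  also have "(\<Sum>k<N. ln (real (prime_part_factorial M k))) = ln (\<Prod>k<N. real (prime_part_factorial M k))"
    by (rule ln_prod[symmetric]) (auto simp: prime_part_factorial_pos)
  finally have "ln (D * fact N * (real L * B) ^ (\<Sum>k<N. k)) < ln (\<Prod>k<N. real (prime_part_factorial M k))"
    by simp
  then have "D * fact N * (real L * B) ^ (\<Sum>k<N. k) < (\<Prod>k<N. real (prime_part_factorial M k))"
    using assms L by (subst (asm) ln_less_cancel_iff) (auto intro!: prod_pos simp: prime_part_factorial_pos)
  then show ?thesis using L that[of L] by (simp add: N_def)
qed

section \<open>Vandermonde determinants\<close>

text \<open>Combining the moments with the coefficients of \<open>h\<close> gives the sum of
  \<open>c \<beta> * poly h \<beta>\<close>. Since \<open>h\<close> vanishes on \<open>S\<close>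
  except at \<open>\<beta>0\<close>, a single term survives.\<close>

lemma coeff_zero_if_moments_zero:
  fixes S :: "complex set" and c :: "complex \<Rightarrow> complex"
  assumes S: "finite S" and zero: "\<And>k. k < card S \<Longrightarrow> (\<Sum>\<beta>\<in>S. c \<beta> * \<beta> ^ k) = 0" and b: "\<beta>0 \<in> S"
  shows "c \<beta>0 = 0"
proof -
  define h where "h = (\<Prod>\<beta>\<in>S - {\<beta>0}. [:- \<beta>, 1:])"
  have "degree h = card (S - {\<beta>0})" unfolding h_def by (subst degree_prod_sum_eq) auto
  then have deg: "degree h < card S" using card.remove[OF S b] by simp
  have "(\<Sum>\<beta>\<in>S. c \<beta> * poly h \<beta>) = (\<Sum>k\<le>degree h. coeff h k * (\<Sum>\<beta>\<in>S. c \<beta> * \<beta> ^ k))"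
    unfolding poly_altdef sum_distrib_left by (subst sum.swap) (simp add: mult_ac)
  also have "\<dots> = 0" using zero deg by (intro sum.neutral) auto
  finally have "(\<Sum>\<beta>\<in>S. c \<beta> * poly h \<beta>) = 0" .
  moreover have "(\<Sum>\<beta>\<in>S. c \<beta> * poly h \<beta>) = (\<Sum>\<beta>\<in>{\<beta>0}. c \<beta> * poly h \<beta>)"
    using S b by (intro sum.mono_neutral_right) (auto simp: h_def poly_prod)
  moreover have "poly h \<beta>0 \<noteq> 0" using S by (auto simp: h_def poly_prod)
  ultimately show ?thesis by simp
qed

definition vandermonde_mat :: "nat \<Rightarrow> (nat \<Rightarrow> 'a::comm_ring_1) \<Rightarrow> 'a mat" where
  "vandermonde_mat N w = mat N N (\<lambda>(r, k). w r ^ k)"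

lemma vandermonde_mat_carrier: "vandermonde_mat N w \<in> carrier_mat N N"
  by (simp add: vandermonde_mat_def)

text \<open>A nonzero kernel vector would consist of the coefficients of a nonzero polynomial of
  degree below \<open>N\<close> with \<open>N\<close> distinct roots.\<close>

lemma inj_on_imp_det_vandermonde_nonzero:
  fixes w :: "nat \<Rightarrow> complex"
  assumes "inj_on w {..<N}"
  shows "det (vandermonde_mat N w) \<noteq> 0"
proof
  assume "det (vandermonde_mat N w) = 0"
  then obtain v where v: "v \<in> carrier_vec N" "v \<noteq> 0\<^sub>v N" "vandermonde_mat N w *\<^sub>v v = 0\<^sub>v N"
    using det_0_iff_vec_prod_zero[OF vandermonde_mat_carrier] by blast
  define q where "q = (\<Sum>k<N. monom (v $ k) k)"
  have cq: "coeff q k = (if k < N then v $ k else 0)" for k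
    by (simp add: q_def coeff_sum)
  have "q \<noteq> 0"
  proof
    assume "q = 0"
    then have "v $ k = 0" if "k < N" for k using cq[of k] that by simp
    then show False using v(1,2) by (auto simp: vec_eq_iff)
  qed
  have root: "poly q (w r) = 0" if "r < N" for r
  proof -
    have "poly q (w r) = (\<Sum>k<N. v $ k * w r ^ k)" by (simp add: q_def poly_sum poly_monom)
    also have "\<dots> = (vandermonde_mat N w *\<^sub>v v) $ r"
      using that v(1) by (simp add: vandermonde_mat_def scalar_prod_def atLeast0LessThan mult.commute)
    finally show ?thesis using v(3) that by simp
  qed
  have N: "N > 0" using v by (cases N) auto
  have "degree q < N" using N cq by (intro le_less_trans[OF degree_le[of "N - 1"]]) auto
  moreover have "card (w ` {..<N}) \<le> card {x. poly q x = 0}"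
    using root \<open>q \<noteq> 0\<close> by (intro card_mono) (auto intro: poly_roots_finite)
  moreover have "card {x. poly q x = 0} \<le> degree q" using \<open>q \<noteq> 0\<close> by (rule card_poly_roots_bound)
  ultimately show False using assms by (simp add: card_image)
qed

text \<open>The falling factorials are monic of degree \<open>k\<close>, so passing to them from the
  powers multiplies by the unitriangular matrix \<open>T\<close>.\<close>

lemma det_falling_product_eq_vandermonde:
  fixes w :: "nat \<Rightarrow> complex"
  shows "det (mat N N (\<lambda>(r, k). \<Prod>j<k. w r - of_nat j)) = det (vandermonde_mat N w)"
proof -
  define q where "q = (\<lambda>k. \<Prod>j<k. [:- of_nat j, 1 :: complex:])"
  have deg: "degree (q k) = k" for k unfolding q_def by (subst degree_prod_sum_eq) auto
  have lead: "coeff (q k) k = 1" for k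
  proof -
    have "lead_coeff (q k) = 1" by (simp add: q_def lead_coeff_prod)
    then show ?thesis by (simp add: deg)
  qed
  define T where "T = mat N N (\<lambda>(i, k). coeff (q k) i)"
  have T: "T \<in> carrier_mat N N" by (simp add: T_def)
  have "upper_triangular T" by (auto simp: upper_triangular_def T_def coeff_eq_0 deg)
  then have "det T = prod_list (diag_mat T)" using T by (rule det_upper_triangular)
  also have "diag_mat T = replicate N 1"
    by (intro nth_equalityI) (auto simp: diag_mat_def T_def lead)
  finally have "det T = 1" by simp
  have "mat N N (\<lambda>(r, k). \<Prod>j<k. w r - of_nat j) = vandermonde_mat N w * T"
  proof (rule eq_matI)
    fix r k assume "r < dim_row (vandermonde_mat N w * T)" "k < dim_col (vandermonde_mat N w * T)"
    then have rk: "r < N" "k < N" by (auto simp: vandermonde_mat_def T_def)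
    have "(\<Prod>j<k. w r - of_nat j) = poly (q k) (w r)" by (simp add: q_def poly_prod)
    also have "\<dots> = (\<Sum>i\<le>k. coeff (q k) i * w r ^ i)" by (simp add: poly_altdef deg)
    also have "\<dots> = (\<Sum>i<N. coeff (q k) i * w r ^ i)"
      using rk by (intro sum.mono_neutral_left) (auto simp: coeff_eq_0 deg)
    finally show "mat N N (\<lambda>(r, k). \<Prod>j<k. w r - of_nat j) $$ (r, k) = (vandermonde_mat N w * T) $$ (r, k)"
      using rk by (simp add: vandermonde_mat_def T_def scalar_prod_def atLeast0LessThan mult.commute)
  qed (auto simp: vandermonde_mat_def T_def)
  then show ?thesis
    using det_mult[OF vandermonde_mat_carrier T] \<open>det T = 1\<close> by simp
qed

lemma alg_dvd_prod:
  assumes "\<And>i. i \<in> I \<Longrightarrow> alg_dvd (m i) (x i)"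
  shows "alg_dvd (prod m I) (prod x I)"
  using assms by (induction I rule: infinite_finite_induct) (auto intro: alg_dvd_mult simp: alg_dvd_1[unfolded One_nat_def])

text \<open>Every product in the Leibniz formula contains exactly one entry of each column.\<close>

lemma alg_dvd_det:
  assumes A: "A \<in> carrier_mat N N"
    and dvd: "\<And>r k. r < N \<Longrightarrow> k < N \<Longrightarrow> alg_dvd (m k) (A $$ (r, k))"
  shows "alg_dvd (\<Prod>k<N. m k) (det A)"
  unfolding det_def'[OF A]
proof (intro alg_dvd_sum alg_dvd_mult_left)
  fix p assume "p \<in> {p. p permutes {0..<N}}"
  then have p: "p permutes {0..<N}" by simp
  have "(\<Prod>i=0..<N. m (p i)) = (\<Prod>k=0..<N. m k)"
    using prod.permute[OF p, of m] by (simp add: o_def)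
  moreover have "alg_dvd (\<Prod>i=0..<N. m (p i)) (\<Prod>i=0..<N. A $$ (i, p i))"
    using permutes_in_image[OF p] by (intro alg_dvd_prod dvd) auto
  ultimately show "alg_dvd (\<Prod>k<N. m k) (\<Prod>i=0..<N. A $$ (i, p i))"
    by (simp add: atLeast0LessThan)
  show "algebraic_int (signof p :: complex)" by (auto simp: sign_def)
qed

text \<open>In each of the \<open>N!\<close> Leibniz terms the exponents add up to
  \<open>0 + ... + (N - 1)\<close>.\<close>

lemma norm_det_vandermonde_le:
  fixes w :: "nat \<Rightarrow> complex"
  assumes "\<And>r. r < N \<Longrightarrow> norm (w r) \<le> B" "B \<ge> 0"
  shows "norm (det (vandermonde_mat N w)) \<le> fact N * B ^ (\<Sum>k<N. k)"
proof -
  have "norm (det (vandermonde_mat N w)) \<le>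
      (\<Sum>p | p permutes {0..<N}. norm (signof p * (\<Prod>i=0..<N. vandermonde_mat N w $$ (i, p i))))"
    unfolding det_def'[OF vandermonde_mat_carrier] by (rule norm_sum)
  also have "\<dots> \<le> (\<Sum>p | p permutes {0..<N}. B ^ (\<Sum>k<N. k))"
  proof (rule sum_mono)
    fix p assume "p \<in> {p. p permutes {0..<N}}"
    then have p: "p permutes {0..<N}" by simp
    have "norm (signof p * (\<Prod>i=0..<N. vandermonde_mat N w $$ (i, p i))) =
        (\<Prod>i=0..<N. norm (vandermonde_mat N w $$ (i, p i)))"
      by (auto simp: sign_def norm_mult prod_norm)
    also have "\<dots> \<le> (\<Prod>i=0..<N. B ^ p i)"
    proof (intro prod_mono conjI norm_ge_zero)
      fix i assume i: "i \<in> {0..<N}"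
      then have "p i < N" using permutes_in_image[OF p, of i] by auto
      then show "norm (vandermonde_mat N w $$ (i, p i)) \<le> B ^ p i"
        using i assms(1)[of i] by (auto simp: vandermonde_mat_def norm_power intro!: power_mono)
    qed
    also have "\<dots> = B ^ (\<Sum>i=0..<N. p i)" by (simp add: power_sum)
    also have "(\<Sum>i=0..<N. p i) = (\<Sum>k<N. k)"
      using sum.permute[OF p, of "\<lambda>i. i"] by (simp add: o_def atLeast0LessThan)
    finally show "norm (signof p * (\<Prod>i=0..<N. vandermonde_mat N w $$ (i, p i))) \<le> B ^ (\<Sum>k<N. k)" .
  qed
  also have "\<dots> = fact N * B ^ (\<Sum>k<N. k)" by (simp add: card_permutations[of "{0..<N}" N])
  finally show ?thesis .
qed

section \<open>Rationality of values fixed by Frobenius modulo all large primes\<close>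

lemma poly_of_int_hom: "comm_ring_hom (\<lambda>h. poly (map_poly of_int h) (\<beta> :: complex))"
  by unfold_locales (simp_all add: of_int_poly_hom.hom_add of_int_poly_hom.hom_mult)

text \<open>The determinants \<open>V \<beta>\<close> are the values of one integer polynomial
  \<open>G\<close>, so the sums of \<open>V \<beta> * \<beta> ^ k\<close> over \<open>S\<close> are
  integers. They are divisible by \<open>m\<close> and smaller than \<open>m\<close>, hence 0, and
  vanishing moments force \<open>V \<beta>0 = 0\<close>. Sums over \<open>S\<close> take the place
  of norms, so no field automorphisms enter.\<close>

lemma rational_if_frobenius_trivial:
  fixes S :: "complex set" and g :: "int poly"
  assumes S: "finite S" "\<And>\<beta>. \<beta> \<in> S \<Longrightarrow> algebraic_int \<beta>"
    and pow: "\<And>n. (\<Sum>\<beta>\<in>S. \<beta> ^ n) \<in> \<int>"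
    and frob: "\<And>\<beta> p. \<beta> \<in> S \<Longrightarrow> prime p \<Longrightarrow> p > M \<Longrightarrow>
      alg_dvd p (poly (map_poly of_int g) \<beta> ^ p - poly (map_poly of_int g) \<beta>)"
    and b0: "\<beta>0 \<in> S"
  shows "poly (map_poly of_int g) \<beta>0 \<in> \<rat>"
proof -
  define u where "u = (\<lambda>\<beta>::complex. poly (map_poly of_int g) \<beta>)"
  have alg_poly: "algebraic_int (poly (map_poly of_int h) \<beta>)" if "\<beta> \<in> S" for h :: "int poly" and \<beta>
    by (rule algebraic_int_poly[OF _ S(2)[OF that]]) (simp add: coeff_map_poly)
  have tr_int: "(\<Sum>\<beta>\<in>S. poly (map_poly of_int h) \<beta>) \<in> \<int>" for h :: "int poly"
  proof -
    have "(\<Sum>\<beta>\<in>S. poly (map_poly of_int h) \<beta>) = (\<Sum>k\<le>degree h. of_int (coeff h k) * (\<Sum>\<beta>\<in>S. \<beta> ^ k))"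
      unfolding poly_altdef sum_distrib_left by (subst sum.swap) (simp add: coeff_map_poly)
    also have "\<dots> \<in> \<int>" by (intro Ints_sum Ints_mult pow) auto
    finally show ?thesis .
  qed
  define C where "C = 1 + Max (insert 0 ((\<lambda>\<beta>. norm (u \<beta>)) ` S))"
  define A0 where "A0 = Max (insert 1 (norm ` S))"
  have C: "1 + norm (u \<beta>) \<le> C" if "\<beta> \<in> S" for \<beta>
    unfolding C_def using S(1) that by (auto intro!: Max_ge)
  have C1: "C \<ge> 1" unfolding C_def using S(1) by (auto intro!: Max_ge)
  have A0: "norm \<beta> \<le> A0" if "\<beta> \<in> S" for \<beta>
    unfolding A0_def using S(1) that by (auto intro!: Max_ge)
  have A01: "A0 \<ge> 1" unfolding A0_def using S(1) by (auto intro!: Max_ge)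
  \<comment> \<open>\<open>D\<close> accounts for the \<open>card S\<close> summands and the weights
    \<open>\<beta> ^ k\<close> with \<open>k < card S\<close> in these sums.\<close>
  define D where "D = real (card S) * A0 ^ card S"
  have "card S > 0" using S(1) b0 by (auto simp: card_gt_0_iff)
  then have "D > 0" using A01 by (simp add: D_def)
  obtain L where L: "L > 0"
    "D * fact (L\<^sup>2) * (real L * C) ^ (\<Sum>k<L\<^sup>2. k) < real (\<Prod>k<L\<^sup>2. prime_part_factorial M k)"
    using exists_factorial_product_large[OF \<open>D > 0\<close>, of C M] C1 by auto
  define N where "N = L\<^sup>2"
  define m where "m = (\<Prod>k<N. prime_part_factorial M k)"
  have m: "m > 0" unfolding m_def by (intro prod_pos) (simp add: prime_part_factorial_pos)
  \<comment> \<open>Remainder and quotient by \<open>L\<close> enumerate the pairs below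
    \<open>L\<close>, so for \<open>r < N\<close> this lists the numbers
    \<open>a + b * u \<beta>\<close>.\<close>
  define w where "w = (\<lambda>\<beta> r. of_nat (r mod L) + of_nat (r div L) * u \<beta>)"
  define V where "V = (\<lambda>\<beta>. det (vandermonde_mat N (w \<beta>)))"
  have norm_V: "norm (V \<beta>) \<le> fact N * (real L * C) ^ (\<Sum>k<N. k)" if "\<beta> \<in> S" for \<beta>
    unfolding V_def
  proof (rule norm_det_vandermonde_le)
    fix r assume "r < N"
    then have "r div L < L" by (simp add: N_def power2_eq_square less_mult_imp_div_less)
    moreover have "r mod L < L" using L by simp
    ultimately have rL: "real (r mod L) \<le> real L" "real (r div L) \<le> real L" by simp_all
    have "norm (w \<beta> r) \<le> real (r mod L) + real (r div L) * norm (u \<beta>)"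
      unfolding w_def by (rule order.trans[OF norm_triangle_ineq]) (simp add: norm_mult)
    also have "\<dots> \<le> real L + real L * norm (u \<beta>)"
      using rL by (intro add_mono mult_right_mono) auto
    also have "\<dots> = real L * (1 + norm (u \<beta>))" by (simp add: ring_distribs)
    also have "\<dots> \<le> real L * C" using C[OF that] by (intro mult_left_mono) auto
    finally show "norm (w \<beta> r) \<le> real L * C" .
  qed (use C1 in auto)
  have dvd_V: "alg_dvd m (V \<beta>)" if "\<beta> \<in> S" for \<beta>
  proof -
    have "alg_dvd m (det (mat N N (\<lambda>(r, k). \<Prod>j<k. w \<beta> r - of_nat j)))"
      unfolding m_def
    proof (rule alg_dvd_det)
      fix r k assume rk: "r < N" "k < N"
      have w: "w \<beta> r = of_int (int (r mod L)) + of_int (int (r div L)) * u \<beta>" by (simp add: w_def)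
      have "alg_dvd (prime_part_factorial M k) (\<Prod>j<k. w \<beta> r - of_nat j)"
      proof (rule alg_dvd_prime_part_factorial)
        show "algebraic_int (w \<beta> r)"
          unfolding w u_def by (intro algebraic_int_add_mult algebraic_int_of_int alg_poly that)
        fix p assume "prime p" "p > M"
        then show "alg_dvd p (w \<beta> r ^ p - w \<beta> r)"
          unfolding w u_def by (intro alg_dvd_frobenius_affine alg_poly frob that)
      qed
      then show "alg_dvd (prime_part_factorial M k) (mat N N (\<lambda>(r, k). \<Prod>j<k. w \<beta> r - of_nat j) $$ (r, k))"
        using rk by simp
    qed simp
    then show ?thesis by (simp add: V_def det_falling_product_eq_vandermonde)
  qed
  \<comment> \<open>The same determinant, formed over the integer polynomials before evaluation at
    \<open>\<beta>\<close>.\<close>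
  define G where "G = det (vandermonde_mat N (\<lambda>r. [:int (r mod L):] + [:int (r div L):] * g))"
  have V_poly: "V \<beta> = poly (map_poly of_int G) \<beta>" for \<beta>
  proof -
    interpret h: comm_ring_hom "\<lambda>h. poly (map_poly of_int h) \<beta>" by (rule poly_of_int_hom)
    have const: "poly (map_poly of_int [:k:]) \<beta> = of_int k" for k
      by (cases "k = 0") (simp_all add: map_poly_pCons)
    have "map_mat (\<lambda>h. poly (map_poly of_int h) \<beta>) (vandermonde_mat N (\<lambda>r. [:int (r mod L):] + [:int (r div L):] * g)) =
        vandermonde_mat N (w \<beta>)"
      by (intro eq_matI) (auto simp: vandermonde_mat_def h.hom_power h.hom_add h.hom_mult w_def u_def const
          simp del: mult_pCons_left add_pCons)
    then show ?thesis unfolding V_def G_def h.hom_det[symmetric] by simp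
  qed
  have "(\<Sum>\<beta>\<in>S. V \<beta> * \<beta> ^ k) = 0" if k: "k < card S" for k
  proof -
    define T where "T = (\<Sum>\<beta>\<in>S. V \<beta> * \<beta> ^ k)"
    have "T = (\<Sum>\<beta>\<in>S. poly (map_poly of_int (G * monom 1 k)) \<beta>)"
      unfolding T_def V_poly by (simp add: of_int_poly_hom.hom_mult poly_monom map_poly_monom)
    then have T_int: "T \<in> \<int>" using tr_int by simp
    have "T = (\<Sum>\<beta>\<in>S. \<beta> ^ k * V \<beta>)" by (simp add: T_def mult.commute)
    also have "alg_dvd m \<dots>"
      using S(2) dvd_V by (intro alg_dvd_sum alg_dvd_mult_left algebraic_int_power)
    finally have "algebraic_int (T / of_nat m)" by (simp add: alg_dvd_def)
    moreover have "T / of_nat m \<in> \<rat>" using T_int Ints_subset_Rats by (intro Rats_divide) auto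
    ultimately have "T / of_nat m \<in> \<int>" by (rule rational_algebraic_int_is_int)
    then obtain z where z: "T / of_nat m = of_int z" by (auto elim: Ints_cases)
    have "norm T \<le> (\<Sum>\<beta>\<in>S. (fact N * (real L * C) ^ (\<Sum>k<N. k)) * A0 ^ card S)"
      unfolding T_def
    proof (rule sum_norm_le)
      fix \<beta> assume b: "\<beta> \<in> S"
      have "norm \<beta> ^ k \<le> A0 ^ k" using A0[OF b] by (intro power_mono) auto
      also have "\<dots> \<le> A0 ^ card S" using A01 k by (intro power_increasing) auto
      finally have "norm (\<beta> ^ k) \<le> A0 ^ card S" by (simp add: norm_power)
      then show "norm (V \<beta> * \<beta> ^ k) \<le> (fact N * (real L * C) ^ (\<Sum>k<N. k)) * A0 ^ card S"
        unfolding norm_mult using norm_V[OF b] C1 by (intro mult_mono) auto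
    qed
    also have "\<dots> = D * fact N * (real L * C) ^ (\<Sum>k<N. k)" by (simp add: D_def algebra_simps)
    also have "\<dots> < real m" using L(2) by (simp add: N_def m_def)
    finally have "norm (T / of_nat m) < 1" using m by (simp add: norm_divide)
    then have "z = 0" unfolding z by (simp flip: of_int_abs)
    then show ?thesis using z m by (simp add: T_def)
  qed
  then have "V \<beta>0 = 0" by (rule coeff_zero_if_moments_zero[OF S(1) _ b0])
  then have "\<not> inj_on (w \<beta>0) {..<N}"
    using inj_on_imp_det_vandermonde_nonzero by (auto simp: V_def)
  then obtain r s where rs: "r \<noteq> s" "w \<beta>0 r = w \<beta>0 s" by (auto simp: inj_on_def)
  \<comment> \<open>Equal quotients would force equal remainders and \<open>r = s\<close>. The
    coincidence is thus a linear equation for \<open>u \<beta>0\<close> with nonzero leading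
    coefficient.\<close>
  have "r div L \<noteq> s div L"
  proof
    assume eq: "r div L = s div L"
    then have "r mod L = s mod L" using rs(2) by (simp add: w_def)
    with eq show False using rs(1) div_mult_mod_eq[of r L] div_mult_mod_eq[of s L] by metis
  qed
  then have "of_nat (r div L) - of_nat (s div L) \<noteq> (0 :: complex)" by simp
  moreover have "(of_nat (r div L) - of_nat (s div L)) * u \<beta>0 = of_nat (s mod L) - of_nat (r mod L)"
    using rs(2) by (simp add: w_def algebra_simps)
  ultimately have "u \<beta>0 = (of_nat (s mod L) - of_nat (r mod L)) / (of_nat (r div L) - of_nat (s div L))"
    by (simp add: field_simps)
  also have "\<dots> \<in> \<rat>" by (intro Rats_divide Rats_diff Rats_of_nat)
  finally show ?thesis by (simp add: u_def)
qed

section \<open>Rational factors and their roots\<close>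

text \<open>The Hankel matrix \<open>H\<close> of the power sums maps the coefficients of
  \<open>g\<close> to the sums of \<open>g(\<beta>) * \<beta> ^ n\<close> for
  \<open>n < card S\<close>. It is nonsingular, as a kernel vector would give a nonzero polynomial
  of degree below \<open>card S\<close> that vanishes on \<open>S\<close>. Cramer's rule then gives
  \<open>g\<close>, with \<open>e = det H\<close>.\<close>

lemma exists_trace_representation:
  fixes S :: "complex set" and A :: "nat \<Rightarrow> int"
  assumes S: "finite S" and pow: "\<And>n. (\<Sum>\<beta>\<in>S. \<beta> ^ n) \<in> \<int>"
  obtains e g where "e \<noteq> 0"
    "\<And>n. n < card S \<Longrightarrow> of_int (e * A n) = (\<Sum>\<beta>\<in>S. poly (map_poly of_int g) \<beta> * \<beta> ^ n)"
proof -
  define d where "d = card S"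
  have "\<forall>n. \<exists>z. (\<Sum>\<beta>\<in>S. \<beta> ^ n) = of_int z" using pow by (auto elim: Ints_cases)
  then obtain P where P: "\<And>n. (\<Sum>\<beta>\<in>S. \<beta> ^ n) = of_int (P n)" by metis
  define H where "H = mat d d (\<lambda>(i, j). P (i + j))"
  have H: "H \<in> carrier_mat d d" by (simp add: H_def)
  define g where "g = (\<lambda>v :: int vec. \<Sum>j<d. monom (v $ j) j)"
  have cg: "coeff (g v) k = (if k < d then v $ k else 0)" for v k
    by (simp add: g_def coeff_sum)
  have Hv: "of_int ((H *\<^sub>v v) $ n) = (\<Sum>\<beta>\<in>S. poly (map_poly of_int (g v)) \<beta> * \<beta> ^ n)"
    if "v \<in> carrier_vec d" "n < d" for v n
  proof -
    have pg: "poly (map_poly of_int (g v)) \<beta> = (\<Sum>j<d. of_int (v $ j) * \<beta> ^ j)" for \<beta> :: complex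
      by (simp add: g_def of_int_poly_hom.hom_sum poly_sum poly_monom map_poly_monom)
    have "(H *\<^sub>v v) $ n = (\<Sum>j<d. P (n + j) * v $ j)"
      using that by (simp add: H_def scalar_prod_def atLeast0LessThan)
    then have "of_int ((H *\<^sub>v v) $ n) = (\<Sum>j<d. (\<Sum>\<beta>\<in>S. \<beta> ^ (n + j)) * of_int (v $ j))"
      by (simp add: P)
    also have "\<dots> = (\<Sum>\<beta>\<in>S. poly (map_poly of_int (g v)) \<beta> * \<beta> ^ n)"
      unfolding pg sum_distrib_right by (subst sum.swap) (simp add: power_add mult_ac)
    finally show ?thesis .
  qed
  have "det H \<noteq> 0"
  proof
    assume "det H = 0"
    then obtain v where v: "v \<in> carrier_vec d" "v \<noteq> 0\<^sub>v d" "H *\<^sub>v v = 0\<^sub>v d"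
      using det_0_iff_vec_prod_zero[OF H] by blast
    have "poly (map_poly of_int (g v)) \<beta> = (0 :: complex)" if "\<beta> \<in> S" for \<beta>
      using coeff_zero_if_moments_zero[OF S _ that, of "poly (map_poly of_int (g v))"]
        Hv[OF v(1)] v(3) by (simp add: d_def)
    then have sub: "S \<subseteq> {x. poly (map_poly of_int (g v)) x = 0}" by auto
    obtain k where k: "k < d" "v $ k \<noteq> 0" using v(1,2) by (auto simp: vec_eq_iff)
    then have "g v \<noteq> 0" using cg[of v k] by auto
    then have nz: "map_poly of_int (g v) \<noteq> (0 :: complex poly)" by simp
    have "card S \<le> card {x. poly (map_poly of_int (g v)) x = (0 :: complex)}"
      using sub nz by (intro card_mono poly_roots_finite)
    also have "\<dots> \<le> degree (map_poly of_int (g v) :: complex poly)" using nz by (rule card_poly_roots_bound)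
    also have "\<dots> \<le> d - 1" using cg k by (intro degree_le) (auto simp: coeff_map_poly)
    finally show False using k by (simp add: d_def)
  qed
  define a where "a = vec d A"
  \<comment> \<open>The adjugate keeps the solution integral.\<close>
  define x where "x = adj_mat H *\<^sub>v a"
  have adj: "adj_mat H \<in> carrier_mat d d" "H * adj_mat H = det H \<cdot>\<^sub>m 1\<^sub>m d"
    using adj_mat[OF H] by auto
  have a: "a \<in> carrier_vec d" by (simp add: a_def)
  have x: "x \<in> carrier_vec d" using adj a by (simp add: x_def)
  have "H *\<^sub>v x = (H * adj_mat H) *\<^sub>v a" 
    unfolding x_def using assoc_mult_mat_vec[OF H adj(1) a] by simp
  also have "\<dots> = det H \<cdot>\<^sub>v a" unfolding adj(2) using a by (intro eq_vecI) auto
  finally have "H *\<^sub>v x = det H \<cdot>\<^sub>v a" .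
  then have "of_int (det H * A n) = (\<Sum>\<beta>\<in>S. poly (map_poly of_int (g x)) \<beta> * \<beta> ^ n)" if "n < card S" for n
    using Hv[OF x, of n] that by (simp add: a_def d_def)
  then show ?thesis using \<open>det H \<noteq> 0\<close> by (intro that)
qed

text \<open>The minimal polynomial, found as a nonzero annihilating polynomial of least degree and
  made monic.\<close>

lemma exists_min_poly:
  fixes \<beta> :: complex and h0 :: "rat poly"
  assumes "h0 \<noteq> 0" "poly (map_poly of_rat h0) \<beta> = 0"
  obtains q :: "rat poly" where "lead_coeff q = 1" "Factorial_Ring.irreducible q"
    "poly (map_poly of_rat q) \<beta> = 0"
    "\<And>h. poly (map_poly of_rat h) \<beta> = 0 \<Longrightarrow> q dvd h"
proof -
  interpret of_rat_poly_hom: map_poly_inj_idom_hom "of_rat :: rat \<Rightarrow> complex" ..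
  obtain q0 :: "rat poly" where q0: "q0 \<noteq> 0" "poly (map_poly of_rat q0) \<beta> = 0"
    and least0: "\<And>h. h \<noteq> 0 \<Longrightarrow> poly (map_poly of_rat h) \<beta> = 0 \<Longrightarrow> degree q0 \<le> degree h"
    using ex_has_least_nat[of "\<lambda>h. h \<noteq> 0 \<and> poly (map_poly of_rat h) \<beta> = 0" h0 degree] assms by auto
  define q where "q = smult (inverse (lead_coeff q0)) q0"
  have q: "lead_coeff q = 1" "q \<noteq> 0" "degree q = degree q0"
    using q0(1) by (auto simp: q_def)
  have root: "poly (map_poly of_rat q) \<beta> = 0"
    using q0(2) by (simp add: q_def of_rat_hom.map_poly_hom_smult)
  have least: "degree q \<le> degree h" if "h \<noteq> 0" "poly (map_poly of_rat h) \<beta> = 0" for h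
    using least0[OF that] q(3) by simp
  have dvd: "q dvd h" if h: "poly (map_poly of_rat h) \<beta> = 0" for h
  proof (rule ccontr)
    assume "\<not> q dvd h"
    then have nz: "h mod q \<noteq> 0" by (simp add: dvd_eq_mod_eq_0)
    have "h = h div q * q + h mod q" by simp
    then have "map_poly of_rat h = map_poly of_rat (h div q) * map_poly of_rat q + (map_poly of_rat (h mod q) :: complex poly)"
      by (metis of_rat_poly_hom.hom_add of_rat_poly_hom.hom_mult)
    then have "poly (map_poly of_rat (h mod q)) \<beta> = 0" using h root by simp
    from least[OF nz this] show False using degree_mod_less[OF q(2), of h] nz by auto
  qed
  have "Factorial_Ring.irreducible q"
  proof (rule irreducibleI)
    show "q \<noteq> 0" by (rule q(2))
    show "\<not> is_unit q"
    proof
      assume "is_unit q"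
      then obtain c where "q = [:c:]" "c \<noteq> 0" using q(2) by (auto simp: is_unit_iff_degree elim!: degree_eq_zeroE)
      then show False using root by (simp add: map_poly_pCons)
    qed
    fix a b assume ab: "q = a * b"
    then have nz: "a \<noteq> 0" "b \<noteq> 0" using q(2) by auto
    have deg: "degree q = degree a + degree b" using ab nz by (simp add: degree_mult_eq)
    have "poly (map_poly of_rat a) \<beta> = 0 \<or> poly (map_poly of_rat b) \<beta> = 0"
      using root by (simp add: ab of_rat_poly_hom.hom_mult)
    then show "is_unit a \<or> is_unit b"
      using least[OF nz(1)] least[OF nz(2)] deg nz by (auto simp: is_unit_iff_degree)
  qed
  then show ?thesis using q(1) root dvd that[of q] by blast
qed

lemma eq_if_monic_irreducible_dvd:
  fixes p q :: "rat poly"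
  assumes "lead_coeff p = 1" "lead_coeff q = 1" "Factorial_Ring.irreducible p" "Factorial_Ring.irreducible q" "p dvd q"
  shows "p = q"
proof -
  obtain c where c: "q = p * c" using assms(5) by auto
  have "is_unit c"
    using irreducibleD[OF assms(4) c] irreducible_not_unit[OF assms(3)] by blast
  then have "degree c = 0" using assms(2) c by (subst (asm) is_unit_iff_degree) auto
  then obtain k where k: "c = [:k:]" by (rule degree_eq_zeroE)
  then have "k = 1" using assms(1,2) c by (cases "k = 0") auto
  then show ?thesis using c k by simp
qed

text \<open>If \<open>a\<close> were a multiple root, cancelling one factor \<open>x - a\<close>
  would leave it a root of the product over the other points.\<close>

lemma rsquarefree_if_dvd_prod_distinct:
  fixes q :: "complex poly"
  assumes S: "finite S" and dvd: "q dvd (\<Prod>\<beta>\<in>S. [:- \<beta>, 1:])"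
  shows "rsquarefree q"
proof -
  have nz: "(\<Prod>\<beta>\<in>S. [:- \<beta>, 1:]) \<noteq> 0" using S by auto
  then have "q \<noteq> 0" using dvd by auto
  moreover have "order a q \<le> 1" for a
  proof (rule ccontr)
    assume "\<not> order a q \<le> 1"
    then have "[:- a, 1:] ^ 2 dvd q" by (subst order_divides) auto
    then have d: "[:- a, 1:] ^ 2 dvd (\<Prod>\<beta>\<in>S. [:- \<beta>, 1:])" using dvd dvd_trans by blast
    then have "[:- a, 1:] dvd (\<Prod>\<beta>\<in>S. [:- \<beta>, 1:])"
      by (metis dvd_mult_left power2_eq_square)
    then have "a \<in> S" using S by (auto simp: dvd_iff_poly_eq_0 poly_prod)
    then have eq: "(\<Prod>\<beta>\<in>S. [:- \<beta>, 1:]) = [:- a, 1:] * (\<Prod>\<beta>\<in>S - {a}. [:- \<beta>, 1:])"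
      using S by (simp add: prod.remove)
    have "[:- a, 1:] dvd (\<Prod>\<beta>\<in>S - {a}. [:- \<beta>, 1:])"
      using d unfolding eq power2_eq_square dvd_mult_cancel_left by simp
    then show False using S by (auto simp: dvd_iff_poly_eq_0 poly_prod)
  qed
  then have "order a q = 0 \<or> order a q = 1" for a by (metis le_neq_implies_less less_one)
  ultimately show ?thesis by (auto simp: rsquarefree_def)
qed

text \<open>In the rational vector space of complex numbers 1 is linearly independent, so a
  functional with value 1 there exists. Applied to a linear relation with integer data, it makes the
  coefficients rational.\<close>

lemma exists_rat_linear_projection:
  obtains \<phi> :: "complex \<Rightarrow> rat" where "\<phi> 1 = 1" "\<And>x y. \<phi> (x + y) = \<phi> x + \<phi> y"
    "\<And>k x. \<phi> (of_int k * x) = of_int k * \<phi> x"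
proof -
  interpret vector_space_pair "\<lambda>q (x :: complex). of_rat q * x" "(*) :: rat \<Rightarrow> rat \<Rightarrow> rat"
    by unfold_locales (auto simp: algebra_simps of_rat_add of_rat_mult)
  have "vs1.independent {1}" using vs1.dependent_single[of 1] by simp
  then obtain \<phi> where lin: "Vector_Spaces.linear (\<lambda>q (x :: complex). of_rat q * x) ((*) :: rat \<Rightarrow> rat \<Rightarrow> rat) \<phi>" and one: "\<forall>x\<in>{1}. \<phi> x = 1"
    using linear_independent_extend[of "{1}" "\<lambda>_. 1"] by blast
  interpret \<phi>: Vector_Spaces.linear "\<lambda>q (x :: complex). of_rat q * x" "(*) :: rat \<Rightarrow> rat \<Rightarrow> rat" \<phi>
    by (rule lin)
  have "\<phi> (of_int k * x) = of_int k * \<phi> x" for k x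
    using \<phi>.scale[of "of_int k" x] by simp
  then show ?thesis using one \<phi>.add that[of \<phi>] by simp
qed

lemma exists_common_denominator:
  fixes f :: "'i \<Rightarrow> rat"
  assumes "finite J"
  obtains c k where "c \<ge> (1::nat)" "\<And>j. j \<in> J \<Longrightarrow> of_nat c * f j = of_int (k j)"
proof -
  have "\<exists>c::nat. c \<ge> 1 \<and> (\<forall>j\<in>J. of_nat c * f j \<in> \<int>)"
    using assms
  proof (induction J rule: finite_induct)
    case (insert j J)
    then obtain c :: nat where c: "c \<ge> 1" "\<forall>j\<in>J. of_nat c * f j \<in> \<int>" by blast
    obtain a b where ab: "f j = of_int a / of_int b" "b > 0"
      using quotient_of_div[of "f j"] quotient_of_denom_pos' by (metis prod.collapse)
    have "of_nat (c * nat b) * f i \<in> \<int>" if "i \<in> insert j J" for i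
    proof (cases "i = j")
      case True
      have "of_nat (c * nat b) * f j = of_int (int c * a)" using ab by simp
      then show ?thesis using True by (metis Ints_of_int)
    next
      case False
      have "of_nat (c * nat b) * f i = of_int b * (of_nat c * f i)" using ab(2) by simp
      moreover have "of_nat c * f i \<in> \<int>" using c(2) that False by auto
      ultimately show ?thesis by (metis Ints_mult Ints_of_int)
    qed
    then show ?case using c(1) ab(2) by (intro exI[of _ "c * nat b"]) auto
  qed auto
  then obtain c :: nat where c: "c \<ge> 1" "\<forall>j\<in>J. of_nat c * f j \<in> \<int>" by blast
  then have "\<forall>j. \<exists>z. j \<in> J \<longrightarrow> of_nat c * f j = of_int z" by (auto elim: Ints_cases)
  then obtain k where "\<And>j. j \<in> J \<Longrightarrow> of_nat c * f j = of_int (k j)" by metis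
  then show ?thesis using c(1) that by blast
qed

lemma dold_sum_scaled:
  assumes "\<And>j. j \<in> J \<Longrightarrow> dold (T j)"
    and "\<And>n. n \<ge> 1 \<Longrightarrow> A n = (\<Sum>j\<in>J. k j * T j n)"
  shows "dold A"
  unfolding dold_def
proof (intro allI impI)
  fix n :: nat assume n: "n \<ge> 1"
  have "(\<Sum>d | d dvd n. moebius_mu d * A (n div d)) =
      (\<Sum>d | d dvd n. \<Sum>j\<in>J. k j * (moebius_mu d * T j (n div d)))"
  proof (intro sum.cong refl)
    fix d assume "d \<in> {d. d dvd n}"
    then have "n div d \<ge> 1" using n by (auto elim!: dvdE)
    then show "moebius_mu d * A (n div d) = (\<Sum>j\<in>J. k j * (moebius_mu d * T j (n div d)))"
      by (simp add: assms(2) sum_distrib_left mult_ac)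
  qed
  also have "\<dots> = (\<Sum>j\<in>J. k j * (\<Sum>d | d dvd n. moebius_mu d * T j (n div d)))"
    by (subst sum.swap) (simp add: sum_distrib_left)
  also have "int n dvd \<dots>"
    using assms(1) n by (intro dvd_sum) (auto intro!: dvd_mult simp: dold_def)
  finally show "int n dvd (\<Sum>d | d dvd n. moebius_mu d * A (n div d))" .
qed

text \<open>The minimal polynomial of \<open>\<beta>\<close> divides \<open>q\<close>, and as both
  are monic and irreducible they coincide.\<close>

lemma root_of_irreducible_imp_dvd:
  fixes q h :: "rat poly" and \<beta> :: complex
  assumes "lead_coeff q = 1" "Factorial_Ring.irreducible q" "poly (map_poly of_rat q) \<beta> = 0"
    and "poly (map_poly of_rat h) \<beta> = 0"
  shows "q dvd h"
proof -
  have "q \<noteq> 0" using assms(1) by auto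
  then obtain p :: "rat poly" where p: "lead_coeff p = 1" "Factorial_Ring.irreducible p"
    "\<And>h. poly (map_poly of_rat h) \<beta> = 0 \<Longrightarrow> p dvd h"
    using exists_min_poly[OF _ assms(3)] by metis
  then have "p = q" using assms(1-3) by (intro eq_if_monic_irreducible_dvd) auto
  then show ?thesis using p(3) assms(4) by simp
qed

lemma map_poly_of_rat_dvd:
  fixes p q :: "rat poly"
  assumes "p dvd q"
  shows "map_poly of_rat p dvd (map_poly of_rat q :: complex poly)"
proof -
  interpret of_rat_poly_hom: map_poly_inj_idom_hom "of_rat :: rat \<Rightarrow> complex" ..
  show ?thesis using assms by (auto simp: of_rat_poly_hom.hom_mult elim!: dvdE)
qed

section \<open>Separable monic integer polynomials and their irreducible factors\<close>

text \<open>\<open>split\<close> makes \<open>p\<close> monic with the simple complex roots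
  \<open>S\<close>. The polynomial is typed as rational because its factors are taken over the
  rationals; \<open>integral\<close> retains that its coefficients are integers.\<close>

locale separable_rat_poly =
  fixes S :: "complex set" and p :: "rat poly"
  assumes finite_roots: "finite S"
    and split: "map_poly of_rat p = (\<Prod>\<beta>\<in>S. [:- \<beta>, 1:])"
    and integral: "\<And>i. coeff (\<Prod>\<beta>\<in>S. [:- \<beta>, 1 :: complex:]) i \<in> \<int>"
begin

lemma root_iff: "poly (map_poly of_rat p) \<beta> = 0 \<longleftrightarrow> \<beta> \<in> S"
  using finite_roots by (auto simp: split poly_prod)

lemma algebraic_int_root:
  assumes "\<beta> \<in> S"
  shows "algebraic_int \<beta>"
proof (rule algebraic_int.intros)
  show "lead_coeff (\<Prod>\<beta>\<in>S. [:- \<beta>, 1 :: complex:]) = 1" by (simp add: lead_coeff_prod)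
  show "poly (\<Prod>\<beta>\<in>S. [:- \<beta>, 1:]) \<beta> = 0" using assms root_iff by (simp add: split)
qed (use integral in auto)

lemma poly_nonzero: "p \<noteq> 0"
  using split finite_roots by auto

lemma factor_roots_subset:
  assumes "q \<in> monic_irreducible_factors p"
  shows "{\<beta>. poly (map_poly of_rat q) \<beta> = 0} \<subseteq> S"
proof
  fix \<beta> assume "\<beta> \<in> {\<beta>. poly (map_poly of_rat q) \<beta> = (0 :: complex)}"
  moreover have "map_poly of_rat q dvd (map_poly of_rat p :: complex poly)"
    using assms by (intro map_poly_of_rat_dvd) (simp add: monic_irreducible_factors_def)
  ultimately have "poly (map_poly of_rat p) \<beta> = 0" by (auto elim!: dvdE)
  then show "\<beta> \<in> S" by (simp add: root_iff)
qed

lemma factor_split: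
  assumes "q \<in> monic_irreducible_factors p"
  shows "map_poly of_rat q = (\<Prod>\<beta> | poly (map_poly of_rat q) \<beta> = 0. [:- \<beta>, 1 :: complex:])"
proof -
  have "map_poly of_rat q dvd (map_poly of_rat p :: complex poly)"
    using assms by (intro map_poly_of_rat_dvd) (simp add: monic_irreducible_factors_def)
  then have "rsquarefree (map_poly of_rat q :: complex poly)"
    unfolding split by (rule rsquarefree_if_dvd_prod_distinct[OF finite_roots])
  moreover have "lead_coeff (map_poly of_rat q :: complex poly) = 1"
    using assms by (simp add: monic_irreducible_factors_def degree_map_poly coeff_map_poly)
  ultimately show ?thesis using complex_poly_decompose_rsquarefree by fastforce
qed

text \<open>Gauss's lemma by way of algebraic integers: the coefficients are polynomial expressions
  in the roots, hence algebraic integers, and they are rational.\<close>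

lemma factor_integral:
  assumes "q \<in> monic_irreducible_factors p"
  shows "coeff (\<Prod>\<beta> | poly (map_poly of_rat q) \<beta> = 0. [:- \<beta>, 1 :: complex:]) i \<in> \<int>"
proof (rule rational_algebraic_int_is_int)
  show "algebraic_int (coeff (\<Prod>\<beta> | poly (map_poly of_rat q) \<beta> = 0. [:- \<beta>, 1 :: complex:]) i)"
    using factor_roots_subset[OF assms] algebraic_int_root
    by (intro algebraic_int_coeff_prod algebraic_int_coeff_linear) auto
  show "coeff (\<Prod>\<beta> | poly (map_poly of_rat q) \<beta> = 0. [:- \<beta>, 1 :: complex:]) i \<in> \<rat>"
    unfolding factor_split[OF assms, symmetric] by (simp add: coeff_map_poly)
qed

text \<open>Every root belongs to exactly one factor, its minimal polynomial.\<close>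

lemma sum_roots_by_factors:
  fixes C :: "nat \<Rightarrow> rat poly" and f :: "complex \<Rightarrow> complex"
  assumes C: "bij_betw C {1..m} (monic_irreducible_factors p)"
  shows "(\<Sum>\<beta>\<in>S. f \<beta>) = (\<Sum>j=1..m. \<Sum>\<beta> | poly (map_poly of_rat (C j)) \<beta> = 0. f \<beta>)"
proof -
  let ?R = "\<lambda>j. {\<beta>. poly (map_poly of_rat (C j)) \<beta> = (0 :: complex)}"
  have mem: "C j \<in> monic_irreducible_factors p" if "j \<in> {1..m}" for j
    using C that by (auto simp: bij_betw_def)
  have "S = (\<Union>j\<in>{1..m}. ?R j)"
  proof (intro equalityI subsetI)
    fix \<beta> assume "\<beta> \<in> S"
    then have root: "poly (map_poly of_rat p) \<beta> = 0" by (simp add: root_iff)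
    obtain q :: "rat poly" where q: "lead_coeff q = 1" "Factorial_Ring.irreducible q"
      "poly (map_poly of_rat q) \<beta> = 0" "\<And>h. poly (map_poly of_rat h) \<beta> = 0 \<Longrightarrow> q dvd h"
      using exists_min_poly[OF poly_nonzero root] by metis
    then have "q \<in> monic_irreducible_factors p"
      using root by (simp add: monic_irreducible_factors_def)
    then obtain j where "j \<in> {1..m}" "q = C j" using C by (metis bij_betw_def imageE)
    then show "\<beta> \<in> (\<Union>j\<in>{1..m}. ?R j)" using q(3) by auto
  qed (use factor_roots_subset mem in blast)
  moreover have "(\<Sum>\<beta>\<in>(\<Union>j\<in>{1..m}. ?R j). f \<beta>) = (\<Sum>j=1..m. \<Sum>\<beta>\<in>?R j. f \<beta>)"
  proof (rule sum.UNION_disjoint)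
    show "\<forall>j\<in>{1..m}. finite (?R j)"
      using factor_roots_subset mem finite_roots finite_subset by blast
    show "\<forall>i\<in>{1..m}. \<forall>j\<in>{1..m}. i \<noteq> j \<longrightarrow> ?R i \<inter> ?R j = {}"
    proof (intro ballI impI equals0I)
      fix i j \<beta> assume ij: "i \<in> {1..m}" "j \<in> {1..m}" "i \<noteq> j" and b: "\<beta> \<in> ?R i \<inter> ?R j"
      have "C i dvd C j"
        using mem[OF ij(1)] b by (intro root_of_irreducible_imp_dvd[of _ \<beta>]) (auto simp: monic_irreducible_factors_def)
      then have "C i = C j"
        using mem[OF ij(1)] mem[OF ij(2)] by (intro eq_if_monic_irreducible_dvd) (auto simp: monic_irreducible_factors_def)
      then show False using C ij unfolding bij_betw_def by (meson inj_onD)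
    qed
  qed auto
  ultimately show ?thesis by simp
qed

lemma power_sum_Ints: "(\<Sum>\<beta>\<in>S. \<beta> ^ n) \<in> \<int>"
proof (cases "n = 0")
  case False
  obtain T where "\<And>n. n \<ge> 1 \<Longrightarrow> of_int (T n) = (\<Sum>\<beta>\<in>S. \<beta> ^ n)"
    using dold_power_sums[OF finite_roots integral] by metis
  from this[of n] False show ?thesis by (metis Ints_of_int One_nat_def Suc_leI neq0_conv)
qed simp

lemma dold_imp_rational_weights:
  fixes A :: "nat \<Rightarrow> int" and g :: "int poly"
  assumes A: "\<And>n. of_int (A n) = (\<Sum>\<beta>\<in>S. poly (map_poly of_int g) \<beta> * \<beta> ^ n)"
    and dold: "dold A" and "\<beta>0 \<in> S"
  shows "poly (map_poly of_int g) \<beta>0 \<in> \<rat>"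
proof -
  define u where "u = (\<lambda>\<beta>::complex. poly (map_poly of_int g) \<beta>)"
  have alg: "algebraic_int (u \<beta>)" if "\<beta> \<in> S" for \<beta>
    unfolding u_def by (rule algebraic_int_poly[OF _ algebraic_int_root[OF that]]) (simp add: coeff_map_poly)
  have "\<exists>M. \<forall>q. prime q \<longrightarrow> q > M \<longrightarrow> alg_dvd q (u \<beta> ^ q - u \<beta>)" if b: "\<beta> \<in> S" for \<beta>
  proof (cases "\<beta> = 0")
    case True
    \<comment> \<open>The isolation argument excludes the root 0, but there \<open>u\<close> is an
      integer and Fermat's theorem suffices.\<close>
    have u: "u \<beta> = of_int (coeff g 0)" by (simp add: u_def True poly_0_coeff_0 coeff_map_poly)
    have "alg_dvd q (of_int (coeff g 0 ^ q - coeff g 0))" if "prime q" for q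
      using prime_dvd_power_minus_self[OF that] prime_gt_0_nat[OF that] by (rule alg_dvd_of_int)
    then show ?thesis unfolding u by simp
  next
    case False
    have "\<And>n. n \<ge> 1 \<Longrightarrow> of_int (A n) = (\<Sum>\<beta>\<in>S. u \<beta> * \<beta> ^ n)"
      unfolding u_def by (rule A)
    then show ?thesis
      using eventually_alg_dvd_frobenius[where u = u and A = A,
          OF finite_roots algebraic_int_root alg _ dold b False] by metis
  qed
  then obtain M where M: "\<And>\<beta> q. \<beta> \<in> S \<Longrightarrow> prime q \<Longrightarrow> q > M \<beta> \<Longrightarrow> alg_dvd q (u \<beta> ^ q - u \<beta>)"
    by metis
  have "alg_dvd q (u \<beta> ^ q - u \<beta>)" if "\<beta> \<in> S" "prime q" "q > Max (M ` S)" for \<beta> q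
  proof -
    have "M \<beta> \<le> Max (M ` S)" using finite_roots that(1) by (intro Max_ge) auto
    then show ?thesis using M that by simp
  qed
  then show ?thesis
    using rational_if_frobenius_trivial[OF finite_roots algebraic_int_root power_sum_Ints _ assms(3), of "Max (M ` S)" g]
    by (simp add: u_def)
qed

end

theorem theorem7:
  fixes d m :: nat and r :: "nat \<Rightarrow> int" and U :: "nat \<Rightarrow> int"
    and \<alpha> :: "nat \<Rightarrow> complex" and K :: "complex set" and C :: "nat \<Rightarrow> rat poly"
  assumes "d \<ge> 1"
    and "\<And>n. n \<ge> d \<Longrightarrow> U n = (\<Sum>i=1..d. r i * U (n - i))"
    and "map_poly of_int (recurrence_poly d r) = (\<Prod>i<d. [:- \<alpha> i, 1:])"
    and "(\<Prod>j<d. \<Prod>i<j. (\<alpha> i - \<alpha> j)\<^sup>2) \<noteq> 0"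
    and "K = rat_adjoin (\<alpha> ` {..<d})"
    and "bij_betw C {1..m} (monic_irreducible_factors (map_poly of_int (recurrence_poly d r)))"
  shows "almost_dold U \<longleftrightarrow>
    (\<exists>l :: nat \<Rightarrow> complex. (\<forall>j\<in>{1..m}. l j \<in> K) \<and>
      (\<forall>n\<ge>1. of_int (U n) =
        (\<Sum>j=1..m. l j * (\<Sum>\<beta> | poly (map_poly of_rat (C j)) \<beta> = 0. \<beta> ^ n))))"
proof -
  define S where "S = \<alpha> ` {..<d}"
  define p :: "rat poly" where "p = map_poly of_int (recurrence_poly d r)"
  define R where "R = (\<lambda>j. {\<beta>. poly (map_poly of_rat (C j)) \<beta> = (0 :: complex)})"
  have neq: "\<alpha> i \<noteq> \<alpha> j" if "i < j" "j < d" for i j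
    using assms(4) that by auto
  have inj: "inj_on \<alpha> {..<d}"
  proof (rule inj_onI)
    fix i j assume "i \<in> {..<d}" "j \<in> {..<d}" "\<alpha> i = \<alpha> j"
    then show "i = j" using neq[of i j] neq[of j i] by (cases i j rule: linorder_cases) auto
  qed
  have card_S: "card S = d" using inj by (simp add: S_def card_image)
  have prod_S: "(\<Prod>\<beta>\<in>S. [:- \<beta>, 1:]) = map_poly of_int (recurrence_poly d r)"
    unfolding assms(3) S_def using inj by (simp add: prod.reindex)
  interpret separable_rat_poly S p
  proof
    show "finite S" by (simp add: S_def)
    show "map_poly of_rat p = (\<Prod>\<beta>\<in>S. [:- \<beta>, 1:])"
      unfolding p_def prod_S by (intro poly_eqI) (simp add: coeff_map_poly)
    show "coeff (\<Prod>\<beta>\<in>S. [:- \<beta>, 1 :: complex:]) i \<in> \<int>" for i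
      unfolding prod_S by (simp add: coeff_map_poly)
  qed
  have C: "bij_betw C {1..m} (monic_irreducible_factors p)"
    using assms(6) by (simp add: p_def)
  have mem: "C j \<in> monic_irreducible_factors p" if "j \<in> {1..m}" for j
    using C that by (auto simp: bij_betw_def)
  \<comment> \<open>The powers of each root obey the recurrence of \<open>U\<close>, so an identity
    between the first \<open>d\<close> terms extends to all \<open>n\<close>.\<close>
  have recurrence: "\<beta> ^ n = (\<Sum>i=1..d. of_int (r i) * \<beta> ^ (n - i))" if "\<beta> \<in> S" "n \<ge> d" for \<beta> n
  proof -
    have "poly (map_poly of_int (recurrence_poly d r)) \<beta> = 0"
      using that(1) finite_roots by (auto simp: prod_S[symmetric] poly_prod)
    then have "\<beta> ^ d = (\<Sum>i=1..d. of_int (r i) * \<beta> ^ (d - i))"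
      by (simp add: recurrence_poly_def of_int_poly_hom.hom_minus of_int_poly_hom.hom_sum
          map_poly_monom poly_monom poly_sum)
    then have "\<beta> ^ (n - d) * \<beta> ^ d = (\<Sum>i=1..d. of_int (r i) * (\<beta> ^ (n - d) * \<beta> ^ (d - i)))"
      by (simp add: sum_distrib_left mult_ac)
    also have "\<dots> = (\<Sum>i=1..d. of_int (r i) * \<beta> ^ (n - i))"
      using that(2) by (intro sum.cong) (auto simp flip: power_add)
    finally show ?thesis using that(2) by (simp flip: power_add)
  qed
  show ?thesis
  proof
    assume "almost_dold U"
    then obtain c :: nat where c: "c \<ge> 1" "dold (\<lambda>n. int c * U n)" by (auto simp: almost_dold_def)
    obtain e g where e: "e \<noteq> 0" and
      init: "\<And>n. n < card S \<Longrightarrow> of_int (e * (int c * U n)) = (\<Sum>\<beta>\<in>S. poly (map_poly of_int g) \<beta> * \<beta> ^ n)"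
      using exists_trace_representation[OF finite_roots power_sum_Ints, of "\<lambda>n. int c * U n"] by metis
    have rep: "of_int (e * (int c * U n)) = (\<Sum>\<beta>\<in>S. poly (map_poly of_int g) \<beta> * \<beta> ^ n)" for n
    proof (induction n rule: less_induct)
      case (less n)
      show ?case
      proof (cases "n < d")
        case False
        have "of_int (e * (int c * U n)) = (\<Sum>i=1..d. of_int (r i) * complex_of_int (e * (int c * U (n - i))))"
          using assms(2)[of n] False by (simp add: sum_distrib_left mult_ac)
        also have "\<dots> = (\<Sum>i=1..d. of_int (r i) * (\<Sum>\<beta>\<in>S. poly (map_poly of_int g) \<beta> * \<beta> ^ (n - i)))"
          using False by (intro sum.cong refl arg_cong2[where f = "(*)"] less.IH) auto
        also have "\<dots> = (\<Sum>\<beta>\<in>S. poly (map_poly of_int g) \<beta> * (\<Sum>i=1..d. of_int (r i) * \<beta> ^ (n - i)))"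
          unfolding sum_distrib_left by (subst sum.swap) (simp add: mult_ac)
        also have "\<dots> = (\<Sum>\<beta>\<in>S. poly (map_poly of_int g) \<beta> * \<beta> ^ n)"
          using False recurrence by (intro sum.cong) auto
        finally show ?thesis .
      qed (use init card_S in simp)
    qed
    have "dold (\<lambda>n. e * (int c * U n))"
      by (rule dold_sum_scaled[of "{()}" "\<lambda>_ n. int c * U n" _ "\<lambda>_. e"]) (use c in auto)
    then have rat: "poly (map_poly of_int g) \<beta> \<in> \<rat>" if "\<beta> \<in> S" for \<beta>
      by (rule dold_imp_rational_weights[OF rep _ that])
    \<comment> \<open>If \<open>g\<close> takes the rational value \<open>q\<close> at one root of
      \<open>C j\<close>, then \<open>g - q\<close> is divisible by \<open>C j\<close>, so
      \<open>g\<close> takes that value at all roots of \<open>C j\<close>.\<close>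
    have "\<exists>q. \<forall>\<beta>\<in>R j. poly (map_poly of_int g) \<beta> = of_rat q" if j: "j \<in> {1..m}" for j
    proof (cases "R j = {}")
      case False
      then obtain \<beta>0 where b0: "\<beta>0 \<in> R j" by blast
      then have "\<beta>0 \<in> S" using factor_roots_subset[OF mem[OF j]] by (auto simp: R_def)
      then obtain q where q: "poly (map_poly of_int g) \<beta>0 = of_rat q" using rat by (auto elim: Rats_cases)
      define h :: "rat poly" where "h = map_poly of_int g - [:q:]"
      have h: "poly (map_poly of_rat h) \<beta> = poly (map_poly of_int g) \<beta> - of_rat q" for \<beta> :: complex
      proof -
        have "map_poly of_rat h = map_poly of_int g - [:of_rat q :: complex:]"
          by (intro poly_eqI) (simp add: h_def coeff_map_poly of_rat_diff coeff_pCons split: nat.splits)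
        then show ?thesis by simp
      qed
      have "C j dvd h"
        using mem[OF j] b0 h[of \<beta>0] q
        by (intro root_of_irreducible_imp_dvd[of _ \<beta>0]) (auto simp: monic_irreducible_factors_def R_def)
      then have "map_poly of_rat (C j) dvd (map_poly of_rat h :: complex poly)" by (rule map_poly_of_rat_dvd)
      then have "poly (map_poly of_rat h) \<beta> = 0" if "\<beta> \<in> R j" for \<beta>
        using that by (auto simp: R_def elim!: dvdE)
      then show ?thesis using h by (intro exI[of _ q]) auto
    qed auto
    then obtain q where q: "\<And>j \<beta>. j \<in> {1..m} \<Longrightarrow> \<beta> \<in> R j \<Longrightarrow> poly (map_poly of_int g) \<beta> = of_rat (q j)"
      by metis
    define k where "k = e * int c"
    have nz: "of_int k \<noteq> (0 :: complex)" using e c by (simp add: k_def)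
    \<comment> \<open>The common value of \<open>g\<close> on the roots of \<open>C j\<close>,
      divided by the factor \<open>k\<close> by which \<open>U\<close> was multiplied.\<close>
    define l where "l = (\<lambda>j. of_rat (q j / of_int k) :: complex)"
    have kl: "of_int k * l j = of_rat (q j)" for j
      using nz by (simp add: l_def of_rat_divide)
    show "\<exists>l :: nat \<Rightarrow> complex. (\<forall>j\<in>{1..m}. l j \<in> K) \<and>
      (\<forall>n\<ge>1. of_int (U n) =
        (\<Sum>j=1..m. l j * (\<Sum>\<beta> | poly (map_poly of_rat (C j)) \<beta> = 0. \<beta> ^ n)))"
    proof (intro exI[of _ l] conjI ballI allI impI)
      fix j assume "j \<in> {1..m}"
      show "l j \<in> K" unfolding assms(5) rat_adjoin_def by (intro generate_field.incl) (simp add: l_def)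
    next
      fix n :: nat assume "n \<ge> 1"
      have "of_int k * complex_of_int (U n) = (\<Sum>\<beta>\<in>S. poly (map_poly of_int g) \<beta> * \<beta> ^ n)"
        using rep[of n] by (simp add: k_def mult_ac)
      also have "\<dots> = (\<Sum>j=1..m. \<Sum>\<beta>\<in>R j. poly (map_poly of_int g) \<beta> * \<beta> ^ n)"
        unfolding R_def by (rule sum_roots_by_factors[OF C])
      also have "\<dots> = (\<Sum>j=1..m. \<Sum>\<beta>\<in>R j. of_rat (q j) * \<beta> ^ n)"
        by (intro sum.cong refl) (simp add: q)
      also have "\<dots> = of_int k * (\<Sum>j=1..m. l j * (\<Sum>\<beta>\<in>R j. \<beta> ^ n))"
        by (simp only: kl[symmetric] sum_distrib_left mult.assoc)
      finally show "of_int (U n) = (\<Sum>j=1..m. l j * (\<Sum>\<beta> | poly (map_poly of_rat (C j)) \<beta> = 0. \<beta> ^ n))"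
        using nz unfolding R_def mult_cancel_left by blast
    qed
  next
    assume "\<exists>l :: nat \<Rightarrow> complex. (\<forall>j\<in>{1..m}. l j \<in> K) \<and>
      (\<forall>n\<ge>1. of_int (U n) =
        (\<Sum>j=1..m. l j * (\<Sum>\<beta> | poly (map_poly of_rat (C j)) \<beta> = 0. \<beta> ^ n)))"
    then obtain l :: "nat \<Rightarrow> complex" where
      l: "\<And>n. n \<ge> 1 \<Longrightarrow> of_int (U n) = (\<Sum>j=1..m. l j * (\<Sum>\<beta>\<in>R j. \<beta> ^ n))"
      unfolding R_def by blast
    have "\<exists>T. dold T \<and> (\<forall>n\<ge>1. of_int (T n) = (\<Sum>\<beta>\<in>R j. \<beta> ^ n))" if "j \<in> {1..m}" for j
      using dold_power_sums[OF finite_subset[OF factor_roots_subset[OF mem[OF that]] finite_roots]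
          factor_integral[OF mem[OF that]]] unfolding R_def by metis
    then obtain T where T: "\<And>j. j \<in> {1..m} \<Longrightarrow> dold (T j)"
      "\<And>j n. j \<in> {1..m} \<Longrightarrow> n \<ge> 1 \<Longrightarrow> of_int (T j n) = (\<Sum>\<beta>\<in>R j. \<beta> ^ n)"
      by metis
    obtain \<phi> :: "complex \<Rightarrow> rat" where \<phi>: "\<phi> 1 = 1" "\<And>x y. \<phi> (x + y) = \<phi> x + \<phi> y"
      "\<And>k x. \<phi> (of_int k * x) = of_int k * \<phi> x"
      using exists_rat_linear_projection by metis
    have \<phi>0: "\<phi> 0 = 0" using \<phi>(3)[of 0 0] by simp
    have \<phi>_sum: "\<phi> (\<Sum>j\<in>J. f j) = (\<Sum>j\<in>J. \<phi> (f j))" for J :: "nat set" and f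
      by (induction J rule: infinite_finite_induct) (auto simp: \<phi>(2) \<phi>0)
    have U: "of_int (U n) = (\<Sum>j=1..m. of_int (T j n) * \<phi> (l j))" if n: "n \<ge> 1" for n
    proof -
      \<comment> \<open>The factor 1 shows the left side as an integer multiple of 1, which
        \<open>\<phi>\<close> maps to \<open>U n\<close>.\<close>
      have "of_int (U n) * 1 = (\<Sum>j=1..m. of_int (T j n) * l j)"
        unfolding l[OF n] mult_1_right using T(2) n by (intro sum.cong) auto
      from arg_cong[OF this, of \<phi>] show ?thesis unfolding \<phi>(3) \<phi>_sum \<phi>(1) by simp
    qed
    \<comment> \<open>The common denominator of the rational coefficients is the constant demanded
      by \<open>almost_dold\<close>.\<close>
    obtain c k where c: "c \<ge> (1::nat)" "\<And>j. j \<in> {1..m} \<Longrightarrow> of_nat c * \<phi> (l j) = of_int (k j)"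
      using exists_common_denominator[of "{1..m}" "\<lambda>j. \<phi> (l j)"] by auto
    have "int c * U n = (\<Sum>j=1..m. k j * T j n)" if n: "n \<ge> 1" for n
    proof -
      have "(of_int (int c * U n) :: rat) = (\<Sum>j=1..m. of_int (T j n) * (of_nat c * \<phi> (l j)))"
        by (simp add: U[OF n] sum_distrib_left mult_ac)
      also have "\<dots> = (\<Sum>j=1..m. of_int (T j n) * of_int (k j))"
        by (intro sum.cong refl) (simp only: c(2))
      also have "\<dots> = of_int (\<Sum>j=1..m. k j * T j n)"
        by (simp add: mult.commute)
      finally show ?thesis by (simp only: of_int_eq_iff)
    qed
    then have "dold (\<lambda>n. int c * U n)"
      using dold_sum_scaled[of "{1..m}" T "\<lambda>n. int c * U n" k] T(1) by blast
    then show "almost_dold U" using c(1) by (auto simp: almost_dold_def)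
  qed
qed

end
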